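(* Let $E \subset \mathbb{P}^n$ be a linear subspace of dimension $n-k-1$. Let $H$ be the Hilbert scheme of closed subschemes of $\mathbb{P}^n$ with a given Hilbert polynomial. Let $H' \subset H$ be the open subset consisting of all points corresponding to $k$-dimensional subschemes that do not intersect $E$. Then the subset $S$ of $H'(\mathbb{R})$ consisting of the points corresponding to subschemes $X$ which are hyperbolic with respect to $E$ and such that the linear projection $X\to\mathbb{P}^k$ from center $E$ is unramified at all real points of $X$ is open with respect to the classical (Euclidean) topology.
   Context: All schemes, morphisms and linear subspaces are defined over $\mathbb{R}$, and $\mathbb{P}^n=\mathbb{P}^n_{\mathbb{R}}$. A closed subscheme $X\subset\mathbb{P}^n$ of dimension $k$ is called hyperbolic with respect to a linear subspace $E\subset\mathbb{P}^n$ of dimension $n-k-1$ if $E\cap X=\emptyset$ and for every (real) linear subspace $U\subset\mathbb{P}^n$ of dimension $n-k$ containing $E$, the intersection $U\cap X$ consists only of real points (points with residue field $\mathbb{R}$). The Hilbert scheme $H$ is a projective scheme over $\mathbb{R}$, so $H(\mathbb{R})$ carries the classical topology; points of $H(\mathbb{R})$ correspond to closed subschemes of $\mathbb{P}^n_{\mathbb{R}}$ with the given Hilbert polynomial. *)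

theory Defs
  imports
    "HOL-Analysis.Analysis"
    "HOL-Library.Poly_Mapping"
    "HOL-Computational_Algebra.Polynomial"
begin

section \<open>The graded ring \<open>\<real>[x\<^sub>0, \<dots>, x\<^sub>n]\<close>\<close>

text \<open>
  The variables are indexed by a finite type \<open>'v\<close> with \<open>n + 1\<close> elements. A linear
  subspace of projective space \<open>P\<^sup>n\<close> of dimension \<open>e\<close> is given by its cone, a vector subspace of
  \<open>real ^ 'v\<close> of dimension \<open>e + 1\<close>.
\<close>

type_synonym 'v rpoly = "('v \<Rightarrow>\<^sub>0 nat) \<Rightarrow>\<^sub>0 real"

definition var :: "'v \<Rightarrow> 'v rpoly" where
  "var v = Poly_Mapping.single (Poly_Mapping.single v 1) 1"

definition const :: "real \<Rightarrow> 'v rpoly" where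
  "const c = Poly_Mapping.single 0 c"

definition forms :: "nat \<Rightarrow> ('v::finite) rpoly set" where
  "forms d = {f. \<forall>m \<in> Poly_Mapping.keys f. (\<Sum>v\<in>UNIV. Poly_Mapping.lookup m v) = d}"

global_interpretation ideal: module "(*) :: 'a::comm_ring_1 \<Rightarrow> 'a \<Rightarrow> 'a"
  by unfold_locales (simp_all add: algebra_simps)

global_interpretation rpoly: vector_space "\<lambda>c (f :: 'v rpoly). const c * f"
proof unfold_locales
  show "const (a + b) * x = const a * x + const b * x" for a b and x :: "'v rpoly"
    by (simp add: const_def single_add distrib_right)
  show "const a * (const b * x) = const (a * b) * x" for a b and x :: "'v rpoly"
    by (simp add: const_def mult_single mult.assoc[symmetric])
qed (simp_all add: const_def distrib_left)

text \<open>Here \<open>ideal.subspace\<close> means ``is an ideal'' and \<open>ideal.span\<close> is the generated ideal, while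
  \<open>rpoly.subspace\<close>, \<open>rpoly.span\<close>, \<open>rpoly.dim\<close> refer to real vector spaces of polynomials.\<close>

definition homogeneous_ideal :: "('v::finite) rpoly set \<Rightarrow> bool" where
  "homogeneous_ideal I \<longleftrightarrow> ideal.subspace I \<and> ideal.span (I \<inter> (\<Union>d. forms d)) = I"

definition prime_ideal :: "'v rpoly set \<Rightarrow> bool" where
  "prime_ideal p \<longleftrightarrow> ideal.subspace p \<and> p \<noteq> UNIV \<and> (\<forall>f g. f * g \<in> p \<longrightarrow> f \<in> p \<or> g \<in> p)"

text \<open>Saturation with respect to the irrelevant ideal.\<close>

definition saturated :: "('v::finite) rpoly set \<Rightarrow> bool" where
  "saturated I \<longleftrightarrow> (\<forall>f. (\<exists>N. \<forall>g \<in> forms N. g * f \<in> I) \<longrightarrow> f \<in> I)"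


section \<open>Closed subschemes of \<open>P\<^sup>n\<close>\<close>

text \<open>
  A closed subscheme \<open>X\<close> of \<open>P\<^sup>n\<close> over the reals is given by its saturated homogeneous ideal \<open>I\<close>.
  Its points are the points of \<open>Proj (S/I)\<close>: the homogeneous prime ideals that contain \<open>I\<close>
  but not the irrelevant ideal.
\<close>

definition proj_points :: "('v::finite) rpoly set \<Rightarrow> 'v rpoly set set" where
  "proj_points I =
    {p. homogeneous_ideal p \<and> prime_ideal p \<and> I \<subseteq> p \<and> \<not> forms 1 \<subseteq> p}"

definition linear_form :: "real ^ 'v \<Rightarrow> ('v::finite) rpoly" where
  "linear_form a = (\<Sum>v\<in>UNIV. const (a $ v) * var v)"

text \<open>The linear forms vanishing on a linear subspace; they generate its ideal.\<close>

definition linear_equations :: "(real ^ 'v) set \<Rightarrow> ('v::finite) rpoly set" where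
  "linear_equations L = {linear_form a | a. \<forall>x\<in>L. inner a x = 0}"

text \<open>The ideal of the scheme-theoretic intersection with a linear subspace.\<close>

definition linear_section :: "(real ^ 'v) set \<Rightarrow> ('v::finite) rpoly set \<Rightarrow> 'v rpoly set" where
  "linear_section L I = ideal.span (I \<union> linear_equations L)"

text \<open>
  The residue field of a point \<open>p\<close> consists of the fractions \<open>f/g\<close> of forms of the same degree
  with \<open>g \<notin> p\<close>, taken modulo \<open>p\<close>. It equals \<open>\<real>\<close> iff every such fraction is
  congruent to a constant.
\<close>

definition real_point :: "('v::finite) rpoly set \<Rightarrow> bool" where
  "real_point p \<longleftrightarrow>
    (\<forall>d. \<forall>f \<in> forms d. \<forall>g \<in> forms d - p. \<exists>c. f - const c * g \<in> p)"

text \<open>Krull dimension of \<open>X\<close>, through chains of points (equivalently, of irreducible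
  closed subsets).\<close>

definition point_chain :: "('v::finite) rpoly set \<Rightarrow> nat \<Rightarrow> bool" where
  "point_chain I k \<longleftrightarrow>
    (\<exists>c. (\<forall>i\<le>k. c i \<in> proj_points I) \<and> (\<forall>i<k. c i \<subset> c (Suc i)))"

definition has_dimension :: "('v::finite) rpoly set \<Rightarrow> nat \<Rightarrow> bool" where
  "has_dimension I k \<longleftrightarrow> point_chain I k \<and> \<not> point_chain I (Suc k)"

definition hyperbolic :: "nat \<Rightarrow> (real ^ 'v) set \<Rightarrow> ('v::finite) rpoly set \<Rightarrow> bool" where
  "hyperbolic k E I \<longleftrightarrow>
    has_dimension I k \<and> subspace E \<and> dim E + k + 1 = CARD('v) \<and>
    proj_points (linear_section E I) = {} \<and>
    (\<forall>U. subspace U \<and> dim U + k = CARD('v) \<and> E \<subseteq> U \<longrightarrow>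
      (\<forall>p \<in> proj_points (linear_section U I). real_point p))"


section \<open>Linear projection and ramification\<close>

text \<open>The homogeneous coordinate ring of the target \<open>P\<^sup>k\<close> of the projection from center \<open>E\<close>, as the
  subalgebra of \<open>\<real>[x\<^sub>0, \<dots>, x\<^sub>n]\<close> generated by the linear forms that vanish on \<open>E\<close>.\<close>

inductive_set projection_ring :: "(real ^ 'v) set \<Rightarrow> ('v::finite) rpoly set"
  for E :: "(real ^ 'v) set" where
    const: "const c \<in> projection_ring E"
  | linear: "f \<in> linear_equations E \<Longrightarrow> f \<in> projection_ring E"
  | add: "f \<in> projection_ring E \<Longrightarrow> g \<in> projection_ring E \<Longrightarrow> f + g \<in> projection_ring E"
  | mult: "f \<in> projection_ring E \<Longrightarrow> g \<in> projection_ring E \<Longrightarrow> f * g \<in> projection_ring E"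

text \<open>
  For a real point \<open>x\<close> of \<open>X\<close> (given by \<open>p\<close>) with image \<open>y\<close> in \<open>P\<^sup>k\<close> (given by the contraction
  \<open>p \<inter> projection_ring E\<close>), both residue fields are \<open>\<real>\<close>, so the projection is unramified
  at \<open>x\<close> iff the maximal ideal of \<open>y\<close> generates the maximal ideal of the local ring
  of \<open>X\<close> at \<open>x\<close>. This local ring consists of the fractions \<open>f/g\<close> of forms of the same degree with
  \<open>g \<notin> p\<close>, modulo \<open>I\<close>; after clearing denominators the condition says that every form
  \<open>f \<in> p\<close> lies, up to a form \<open>s \<notin> p\<close>, in the ideal generated by \<open>I\<close> and
  \<open>p \<inter> projection_ring E\<close>.
\<close>

definition unramified_at_real_point ::
    "(real ^ 'v) set \<Rightarrow> ('v::finite) rpoly set \<Rightarrow> 'v rpoly set \<Rightarrow> bool" where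
  "unramified_at_real_point E I p \<longleftrightarrow>
    (\<forall>d. \<forall>f \<in> p \<inter> forms d.
      \<exists>e. \<exists>s \<in> forms e - p. s * f \<in> ideal.span (I \<union> (p \<inter> projection_ring E)))"


section \<open>The real points of the Hilbert scheme\<close>

definition has_hilbert_polynomial :: "('v::finite) rpoly set \<Rightarrow> rat poly \<Rightarrow> bool" where
  "has_hilbert_polynomial I P \<longleftrightarrow>
    (\<forall>\<^sub>F d in sequentially.
      of_nat (rpoly.dim (forms d :: 'v rpoly set)) - of_nat (rpoly.dim (I \<inter> forms d))
        = poly P (of_nat d))"

definition hilbert_points :: "rat poly \<Rightarrow> ('v::finite) rpoly set set" where
  "hilbert_points P = {I. homogeneous_ideal I \<and> saturated I \<and> has_hilbert_polynomial I P}"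

text \<open>Only finitely many coefficients of a form of degree \<open>d\<close> can be nonzero, so the topology of
  coefficientwise convergence is the Euclidean topology of this vector space.\<close>

definition forms_topology :: "nat \<Rightarrow> ('v::finite) rpoly topology" where
  "forms_topology d = pullback_topology (forms d) Poly_Mapping.lookup euclidean"

definition frames_topology :: "nat \<Rightarrow> nat \<Rightarrow> (nat \<Rightarrow> ('v::finite) rpoly) topology" where
  "frames_topology d r =
    subtopology (product_topology (\<lambda>_. forms_topology d) {..<r})
      {b. inj_on b {..<r} \<and> rpoly.independent (b ` {..<r})}"

text \<open>
  The disjoint union, over all \<open>r\<close>, of the Grassmannians of \<open>r\<close>-dimensional subspaces of the space
  of forms of degree \<open>d\<close>. Each of them carries the quotient topology from the space of
  \<open>r\<close>-frames.
\<close>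

definition grassmannian_open :: "nat \<Rightarrow> ('v::finite) rpoly set set \<Rightarrow> bool" where
  "grassmannian_open d W \<longleftrightarrow>
    (\<forall>V\<in>W. rpoly.subspace V \<and> V \<subseteq> forms d) \<and>
    (\<forall>r. openin (frames_topology d r)
      {b \<in> topspace (frames_topology d r). rpoly.span (b ` {..<r}) \<in> W})"

definition grassmannian_topology :: "nat \<Rightarrow> ('v::finite) rpoly set topology" where
  "grassmannian_topology d = topology (grassmannian_open d)"

lemma istopology_grassmannian_open: "istopology (grassmannian_open d)"
proof -
  have "grassmannian_open d (S \<inter> T)" if S: "grassmannian_open d S" and T: "grassmannian_open d T"
    for S T :: "'a rpoly set set"
  proof -
    have "{b \<in> topspace (frames_topology d r). rpoly.span (b ` {..<r}) \<in> S \<inter> T}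
        = {b \<in> topspace (frames_topology d r). rpoly.span (b ` {..<r}) \<in> S}
        \<inter> {b \<in> topspace (frames_topology d r). rpoly.span (b ` {..<r}) \<in> T}" for r
      by blast
    then show ?thesis
      using S T by (simp add: grassmannian_open_def openin_Int)
  qed
  moreover have "grassmannian_open d (\<Union>K)" if K: "\<forall>S\<in>K. grassmannian_open d S"
    for K :: "'a rpoly set set set"
  proof -
    have "{b \<in> topspace (frames_topology d r). rpoly.span (b ` {..<r}) \<in> \<Union>K}
        = (\<Union>S\<in>K. {b \<in> topspace (frames_topology d r). rpoly.span (b ` {..<r}) \<in> S})" for r
      by blast
    moreover have "openin (frames_topology d r)
        (\<Union>S\<in>K. {b \<in> topspace (frames_topology d r). rpoly.span (b ` {..<r}) \<in> S})" for r
      using K by (intro openin_Union) (auto simp: grassmannian_open_def)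
    ultimately show ?thesis
      using K by (auto simp: grassmannian_open_def)
  qed
  ultimately show ?thesis
    by (simp add: istopology_def)
qed

lemma openin_grassmannian_topology: "openin (grassmannian_topology d) = grassmannian_open d"
  by (simp add: grassmannian_topology_def istopology_grassmannian_open topology_inverse')

text \<open>The topology induced on the Hilbert scheme by \<open>I \<mapsto> I\<^sub>d\<close>, the degree \<open>d\<close> part.\<close>

definition hilbert_topology_in_degree ::
    "rat poly \<Rightarrow> nat \<Rightarrow> ('v::finite) rpoly set topology" where
  "hilbert_topology_in_degree P d =
    pullback_topology (hilbert_points P) (\<lambda>I. I \<inter> forms d) (grassmannian_topology d)"

text \<open>
  The Hilbert scheme is constructed as a closed subscheme of a Grassmannian through \<open>I \<mapsto> I\<^sub>d\<close>,
  for any \<open>d\<close> that is large enough (at least the Gotzmann number of \<open>P\<close>), so the classical topology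
  is the common topology induced in all sufficiently large degrees. We express this by taking
  neighbourhoods in all sufficiently large degrees, without referring to an explicit bound;
  the lemma \<open>hilbert_topology_eqI\<close> below shows that the result is the induced topology as soon
  as this topology is independent of the degree from some degree on.
\<close>

definition hilbert_open :: "rat poly \<Rightarrow> ('v::finite) rpoly set set \<Rightarrow> bool" where
  "hilbert_open P A \<longleftrightarrow> A \<subseteq> hilbert_points P \<and>
    (\<forall>I\<in>A. \<forall>\<^sub>F d in sequentially.
      \<exists>B. openin (hilbert_topology_in_degree P d) B \<and> I \<in> B \<and> B \<subseteq> A)"

definition hilbert_topology :: "rat poly \<Rightarrow> ('v::finite) rpoly set topology" where
  "hilbert_topology P = topology (hilbert_open P)"

lemma istopology_hilbert_open: "istopology (hilbert_open P)"
proof -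
  have "hilbert_open P (S \<inter> T)" if S: "hilbert_open P S" and T: "hilbert_open P T"
    for S T :: "'a rpoly set set"
  proof -
    have "\<forall>\<^sub>F d in sequentially.
        \<exists>B. openin (hilbert_topology_in_degree P d) B \<and> I \<in> B \<and> B \<subseteq> S \<inter> T"
      if I: "I \<in> S \<inter> T" for I
    proof -
      have "\<forall>\<^sub>F d in sequentially. \<exists>B. openin (hilbert_topology_in_degree P d) B \<and> I \<in> B \<and> B \<subseteq> S"
        "\<forall>\<^sub>F d in sequentially. \<exists>B. openin (hilbert_topology_in_degree P d) B \<and> I \<in> B \<and> B \<subseteq> T"
        using S T I by (auto simp: hilbert_open_def)
      then show ?thesis
      proof eventually_elim
        case (elim d)
        then obtain B C where
          "openin (hilbert_topology_in_degree P d) B" "I \<in> B" "B \<subseteq> S"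
          "openin (hilbert_topology_in_degree P d) C" "I \<in> C" "C \<subseteq> T"
          by blast
        then show ?case
          by (intro exI[of _ "B \<inter> C"]) (auto intro: openin_Int)
      qed
    qed
    then show ?thesis
      using S by (auto simp: hilbert_open_def)
  qed
  moreover have "hilbert_open P (\<Union>K)" if K: "\<forall>S\<in>K. hilbert_open P S"
    for K :: "'a rpoly set set set"
  proof -
    have "\<forall>\<^sub>F d in sequentially.
        \<exists>B. openin (hilbert_topology_in_degree P d) B \<and> I \<in> B \<and> B \<subseteq> \<Union>K"
      if "S \<in> K" "I \<in> S" for S I
    proof -
      have "\<forall>\<^sub>F d in sequentially. \<exists>B. openin (hilbert_topology_in_degree P d) B \<and> I \<in> B \<and> B \<subseteq> S"
        using K that by (auto simp: hilbert_open_def)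
      then show ?thesis
        by eventually_elim (use that in blast)
    qed
    moreover have "\<Union>K \<subseteq> hilbert_points P"
      using K by (auto simp: hilbert_open_def)
    ultimately show ?thesis
      by (auto simp: hilbert_open_def)
  qed
  ultimately show ?thesis
    by (simp add: istopology_def)
qed

lemma openin_hilbert_topology: "openin (hilbert_topology P) = hilbert_open P"
  by (simp add: hilbert_topology_def istopology_hilbert_open topology_inverse')

lemma hilbert_topology_eqI:
  fixes T :: "('v::finite) rpoly set topology"
  assumes "\<And>d. d \<ge> d0 \<Longrightarrow> hilbert_topology_in_degree P d = T"
  shows "hilbert_topology P = T"
proof -
  have sub: "B \<subseteq> hilbert_points P" if "openin T B" for B
    using that assms[of d0]
    by (auto simp: hilbert_topology_in_degree_def openin_pullback_topology)
  have "hilbert_open P A \<longleftrightarrow> openin T A" for A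
  proof
    assume A: "hilbert_open P A"
    have "\<exists>B. openin T B \<and> I \<in> B \<and> B \<subseteq> A" if I: "I \<in> A" for I
    proof -
      obtain d1 where d1: "\<And>d. d \<ge> d1 \<Longrightarrow>
          \<exists>B. openin (hilbert_topology_in_degree P d) B \<and> I \<in> B \<and> B \<subseteq> A"
        using A I unfolding hilbert_open_def eventually_sequentially by meson
      show ?thesis
        using d1[of "max d0 d1"] assms[of "max d0 d1"] by simp
    qed
    then show "openin T A"
      by (subst openin_subopen) blast
  next
    assume A: "openin T A"
    have "\<forall>\<^sub>F d in sequentially. hilbert_topology_in_degree P d = T"
      using assms by (auto simp: eventually_sequentially)
    then have "\<forall>\<^sub>F d in sequentially.
        \<exists>B. openin (hilbert_topology_in_degree P d) B \<and> I \<in> B \<and> B \<subseteq> A" if "I \<in> A" for I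
      by eventually_elim (use A that in blast)
    then show "hilbert_open P A"
      using sub[OF A] by (simp add: hilbert_open_def)
  qed
  then show ?thesis
    by (simp add: topology_eq openin_hilbert_topology)
qed

text \<open>The real points of the open subset of \<open>k\<close>-dimensional subschemes that do not meet \<open>E\<close>.\<close>

definition hilbert_points_off ::
    "rat poly \<Rightarrow> nat \<Rightarrow> (real ^ 'v) set \<Rightarrow> ('v::finite) rpoly set set" where
  "hilbert_points_off P k E =
    {I \<in> hilbert_points P. has_dimension I k \<and> proj_points (linear_section E I) = {}}"

end

theory Submission
  imports Defs
begin

text \<open>
  Let \<open>X\<close> be a subscheme that misses the center \<open>E\<close>. The fibres of the projection from \<open>E\<close> over the real
  points of the target are the sections of \<open>X\<close> by the subspaces \<open>span (insert u E)\<close>, where \<open>u\<close> is a unit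
  vector orthogonal to \<open>E\<close>. The homogeneous coordinate ring of such a fibre is finite over
  \<open>\<real>[t]\<close> with \<open>t = linear_form u\<close>, so the fibre is a finite scheme. That \<open>X\<close> is hyperbolic with respect to
  \<open>E\<close> says that all points of all these fibres are real; that the projection is
  unramified at the real points says that all these points are reduced. Both together mean that the
  algebra of every fibre is a product of copies of \<open>\<real>\<close>.

  A finite \<open>\<real>\<close>-algebra is a product of copies of \<open>\<real>\<close> iff it is generated by one element \<open>l\<close> that is
  annihilated by a polynomial with distinct real roots: if the algebra is such a product, take for
  \<open>l\<close> a linear form with different values at the finitely many points. The predicate \<open>splits\<close> expresses this
  criterion for a homogeneous ideal, in one fixed degree \<open>D\<close>: a homogenized polynomial with simple
  real roots lies in the ideal, and modulo the ideal all forms of degree \<open>D\<close> are homogenized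
  polynomials in \<open>l\<close> whose degree is less than the number of these roots. The lemmas
  \<open>splits_real_point\<close>, \<open>splits_unramified\<close> and \<open>splits_if_real_reduced\<close> relate it to points. Points
  are provided by one principle, \<open>homogeneous_prime_avoiding\<close>: a homogeneous ideal that is disjoint
  from a multiplicative set is contained in a homogeneous prime ideal with this property.

  The criterion is stable under perturbation (\<open>splits_perturbation\<close>). In degree \<open>D\<close> it
  depends only on the vector \<open>u\<close> and on the degree \<open>D\<close> part of the ideal of \<open>X\<close>; a family of forms that
  generates the space of all forms of degree \<open>D\<close> still does so after a small change
  (\<open>basis_perturbation\<close>), and simple real roots persist (\<open>root_poly_perturbation\<close>). The vectors \<open>u\<close> form a
  compact set. Hence the condition that all fibres split in degree \<open>D\<close> defines an open set in the
  Grassmannian, and when all fibres split, they do so in a common degree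
  (\<open>totally_split_if_pointwise\<close>). As the criterion passes from \<open>D\<close> to all higher degrees, the
  subschemes whose fibres all split form an open set in the topology of the Hilbert scheme, and among the
  subschemes of dimension \<open>k\<close> that miss \<open>E\<close> they are those of the theorem.
\<close>

section \<open>Homogeneous components\<close>

text \<open>For the module structure of a ring over itself, \<open>scale_scale\<close> is associativity, oriented
  against the rule in \<open>algebra_simps\<close>; the two would loop.\<close>

declare ideal.scale_scale [simp del] rpoly.scale_scale [simp del]

definition mdeg :: "('v::finite \<Rightarrow>\<^sub>0 nat) \<Rightarrow> nat" where
  "mdeg m = (\<Sum>v\<in>UNIV. Poly_Mapping.lookup m v)"

lemma mdeg_add: "mdeg (m + m') = mdeg m + mdeg m'"
  by (simp add: mdeg_def lookup_add sum.distrib)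

lemma mdeg_zero [simp]: "mdeg 0 = 0"
  by (simp add: mdeg_def)

lemma mdeg_single [simp]: "mdeg (Poly_Mapping.single v k) = k"
  by (simp add: mdeg_def lookup_single when_def)

lemma forms_iff: "f \<in> forms d \<longleftrightarrow> (\<forall>m. Poly_Mapping.lookup f m \<noteq> 0 \<longrightarrow> mdeg m = d)"
  by (auto simp: forms_def mdeg_def in_keys_iff)

lift_definition component :: "nat \<Rightarrow> ('v::finite) rpoly \<Rightarrow> 'v rpoly"
  is "\<lambda>d f m. if mdeg m = d then f m else 0"
  by (rule finite_subset[rotated]) auto

lemma component_add: "component d (f + g) = component d f + component d g"
  by (rule poly_mapping_eqI) (simp add: component.rep_eq lookup_add)

lemma component_zero [simp]: "component d 0 = 0"
  by (rule poly_mapping_eqI) (simp add: component.rep_eq)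

lemma component_sum: "component d (sum f A) = (\<Sum>i\<in>A. component d (f i))"
  by (induction A rule: infinite_finite_induct) (simp_all add: component_add)

lemma component_in_forms [simp]: "component d f \<in> forms d"
  by (simp add: forms_iff component.rep_eq)

lemma component_form: "f \<in> forms e \<Longrightarrow> component d f = (if d = e then f else 0)"
  by (rule poly_mapping_eqI) (auto simp: component.rep_eq forms_iff)

lemma sum_components:
  obtains B where "\<And>n. n \<ge> B \<Longrightarrow> f = (\<Sum>d\<le>n. component d f)"
proof
  fix n assume n: "n \<ge> Max (insert 0 (mdeg ` Poly_Mapping.keys f))"
  show "f = (\<Sum>d\<le>n. component d f)"
  proof (rule poly_mapping_eqI)
    fix m
    show "Poly_Mapping.lookup f m = Poly_Mapping.lookup (\<Sum>d\<le>n. component d f) m"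
    proof (cases "m \<in> Poly_Mapping.keys f")
      case True
      then have "mdeg m \<le> n"
        using n by (simp add: Max_ge_iff)
      then show ?thesis
        by (simp add: lookup_sum component.rep_eq)
    next
      case False
      then show ?thesis
        by (simp add: lookup_sum component.rep_eq in_keys_iff)
    qed
  qed
qed

lemma forms_zero [simp]: "0 \<in> forms d"
  by (simp add: forms_iff)

lemma forms_add: "f \<in> forms d \<Longrightarrow> g \<in> forms d \<Longrightarrow> f + g \<in> forms d"
  unfolding forms_iff lookup_add by (metis add.left_neutral)

lemma forms_sum: "(\<And>i. i \<in> A \<Longrightarrow> f i \<in> forms d) \<Longrightarrow> sum f A \<in> forms d"
  by (induction A rule: infinite_finite_induct) (auto simp: forms_add)

lemma forms_diff: "f \<in> forms d \<Longrightarrow> g \<in> forms d \<Longrightarrow> f - g \<in> forms d"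
  unfolding forms_iff lookup_minus by (metis diff_zero)

lemma forms_mult: "f \<in> forms d \<Longrightarrow> g \<in> forms e \<Longrightarrow> f * g \<in> forms (d + e)"
  using keys_mult[of f g] by (fastforce simp: forms_def lookup_add sum.distrib)

lemma const_in_forms [simp]: "const c \<in> forms 0"
  by (simp add: forms_iff const_def lookup_single when_def)

lemma const_mult_forms: "f \<in> forms d \<Longrightarrow> const c * f \<in> forms d"
  using forms_mult[OF const_in_forms] by fastforce

lemma const_1 [simp]: "const 1 = 1"
  by (simp add: const_def)

lemma const_0 [simp]: "const 0 = 0"
  by (simp add: const_def)

lemma const_add: "const (a + b) = const a + const b"
  by (simp add: const_def single_add)

lemma const_diff: "const (a - b) = const a - const b"
  by (simp add: const_def single_diff)

lemma const_uminus: "const (- a) = - const a"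
  by (simp add: const_def single_uminus)

lemma const_mult: "const (a * b) = const a * const b"
  by (simp add: const_def mult_single)

lemma const_sum: "const (sum f A) = (\<Sum>i\<in>A. const (f i))"
  by (induction A rule: infinite_finite_induct) (auto simp: const_add)

lemma lookup_const_mult: "Poly_Mapping.lookup (const c * f) m = c * Poly_Mapping.lookup f m"
  by (simp add: const_def flip: mult_map_scale_conv_mult) (simp add: Poly_Mapping.map.rep_eq when_def)

lemma one_in_forms [simp]: "1 \<in> forms 0"
  using const_in_forms[of 1] by simp

lemma forms_power: "f \<in> forms d \<Longrightarrow> f ^ e \<in> forms (d * e)"
  by (induction e) (auto simp: forms_mult)

lemma var_in_forms [simp]: "var v \<in> forms 1"
  by (simp add: forms_iff var_def lookup_single when_def)

lemma linear_form_in_forms [simp]: "linear_form a \<in> forms 1"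
  unfolding linear_form_def by (intro forms_sum const_mult_forms var_in_forms)

lemma component_mult_form:
  assumes "g \<in> forms e"
  shows "component d (f * g) = (if e \<le> d then component (d - e) f * g else 0)"
proof -
  obtain B where B: "f = (\<Sum>i\<le>n. component i f)" if "n \<ge> B" for n
    using sum_components by blast
  have "component d (f * g) = component d (\<Sum>i\<le>max B d. component i f * g)"
    using B[of "max B d"] by (simp flip: sum_distrib_right)
  also have "\<dots> = (\<Sum>i\<le>max B d. if i + e = d then component i f * g else 0)"
    unfolding component_sum
    by (rule sum.cong) (auto simp: component_form[OF forms_mult[OF component_in_forms assms]])
  also have "\<dots> = (\<Sum>i\<le>max B d. if i = d - e then if e \<le> d then component i f * g else 0 else 0)"
    by (rule sum.cong) auto
  finally show ?thesis
    by (simp add: le_max_iff_disj)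
qed

lemma component_mult: "component d (f * g) = (\<Sum>i\<le>d. component (d - i) f * component i g)"
proof -
  obtain B where B: "g = (\<Sum>i\<le>n. component i g)" if "n \<ge> B" for n
    using sum_components by blast
  have "component d (f * g) = component d (\<Sum>i\<le>max B d. f * component i g)"
    using B[of "max B d"] by (simp flip: sum_distrib_left)
  also have "\<dots> = (\<Sum>i\<le>max B d. if i \<le> d then component (d - i) f * component i g else 0)"
    by (simp add: component_sum component_mult_form[OF component_in_forms])
  also have "\<dots> = (\<Sum>i\<in>{..max B d} \<inter> {i. i \<le> d}. component (d - i) f * component i g)"
    by (subst sum.inter_restrict) auto
  also have "{..max B d} \<inter> {i. i \<le> d} = {..d}"
    by auto
  finally show ?thesis .
qed

section \<open>Homogeneous ideals\<close>

lemma homogeneous_ideal_span: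
  assumes "X \<subseteq> (\<Union>d. forms d)"
  shows "homogeneous_ideal (ideal.span X)"
proof -
  have "ideal.span X \<subseteq> ideal.span (ideal.span X \<inter> (\<Union>d. forms d))"
    using assms by (intro ideal.span_mono) (auto intro: ideal.span_base)
  moreover have "ideal.span (ideal.span X \<inter> (\<Union>d. forms d)) \<subseteq> ideal.span X"
    by (metis Int_lower1 ideal.span_mono ideal.span_span)
  ultimately show ?thesis
    by (auto simp: homogeneous_ideal_def)
qed

lemma homogeneous_idealD: "homogeneous_ideal I \<Longrightarrow> ideal.subspace I"
  by (simp add: homogeneous_ideal_def)

lemma homogeneous_ideal_component:
  assumes I: "homogeneous_ideal I" and f: "f \<in> I"
  shows "component d f \<in> I"
proof -
  have sub: "ideal.subspace I"
    using I by (rule homogeneous_idealD)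
  have "f \<in> ideal.span (I \<inter> (\<Union>d. forms d))"
    using I f by (simp add: homogeneous_ideal_def)
  then show ?thesis
  proof (induction rule: ideal.span_induct_alt)
    case base
    then show ?case
      using sub by (simp add: ideal.subspace_0)
  next
    case (step c x y)
    then obtain e where "x \<in> forms e" "x \<in> I"
      by blast
    then show ?case
      using sub step by (simp add: component_add component_mult_form ideal.subspace_0
          ideal.subspace_add ideal.subspace_scale)
  qed
qed

lemma mem_if_components:
  assumes sub: "ideal.subspace I" and c: "\<And>d. component d f \<in> I"
  shows "f \<in> I"
proof -
  obtain B where "f = (\<Sum>d\<le>B. component d f)"
    using sum_components by (metis order_refl)
  then show ?thesis
    using ideal.subspace_sum[OF sub, of "{..B}" "\<lambda>d. component d f"] c by simp
qed

lemma homogeneous_idealI: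
  assumes sub: "ideal.subspace I" and c: "\<And>f d. f \<in> I \<Longrightarrow> component d f \<in> I"
  shows "homogeneous_ideal I"
proof -
  have "f \<in> ideal.span (I \<inter> (\<Union>d. forms d))" if "f \<in> I" for f
    by (rule mem_if_components[OF ideal.subspace_span], rule ideal.span_base)
      (use c[OF that] component_in_forms in blast)
  moreover have "ideal.span (I \<inter> (\<Union>d. forms d)) \<subseteq> I"
    using sub by (intro ideal.span_minimal) auto
  ultimately show ?thesis
    using sub by (auto simp: homogeneous_ideal_def)
qed

text \<open>For \<open>f\<close> and \<open>g\<close> outside \<open>p\<close>, consider their components of lowest degrees \<open>a\<close> and \<open>b\<close> that
  are not in \<open>p\<close>: modulo \<open>p\<close>, the component of \<open>f * g\<close> of degree \<open>a + b\<close> is the product of these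
  two.\<close>

lemma homogeneous_prime_idealI:
  assumes p: "homogeneous_ideal p" and ne: "1 \<notin> p"
    and prime: "\<And>f g d e. f \<in> forms d \<Longrightarrow> g \<in> forms e \<Longrightarrow> f * g \<in> p \<Longrightarrow> f \<in> p \<or> g \<in> p"
  shows "prime_ideal p"
proof -
  have sub: "ideal.subspace p"
    using p by (rule homogeneous_idealD)
  have low: "\<exists>d. component d f \<notin> p \<and> (\<forall>i<d. component i f \<in> p)" if "f \<notin> p" for f
  proof -
    have "\<exists>d. component d f \<notin> p"
      using mem_if_components[OF sub] that by blast
    then show ?thesis
      using exists_least_iff[of "\<lambda>d. component d f \<notin> p"] by blast
  qed
  have "f \<in> p \<or> g \<in> p" if fg: "f * g \<in> p" for f g
  proof (rule ccontr)
    assume "\<not> ?thesis"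
    then obtain a b where a: "component a f \<notin> p" "\<forall>i<a. component i f \<in> p"
      and b: "component b g \<notin> p" "\<forall>i<b. component i g \<in> p"
      using low by blast
    let ?t = "\<lambda>i. component (a + b - i) f * component i g"
    have "(\<Sum>i\<in>{..a+b} - {b}. ?t i) \<in> p"
    proof (rule ideal.subspace_sum[OF sub])
      fix i assume i: "i \<in> {..a+b} - {b}"
      show "?t i \<in> p"
      proof (cases "i < b")
        case True
        then show ?thesis
          using b ideal.subspace_scale[OF sub] by blast
      next
        case False
        then have "a + b - i < a"
          using i by auto
        then have "component i g * component (a + b - i) f \<in> p"
          using a ideal.subspace_scale[OF sub] by blast
        then show ?thesis
          by (simp add: mult.commute)
      qed
    qed
    moreover have split: "component (a + b) (f * g) = ?t b + (\<Sum>i\<in>{..a+b} - {b}. ?t i)"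
      unfolding component_mult by (rule sum.remove) auto
    moreover have "component (a + b) (f * g) \<in> p"
      using p fg by (rule homogeneous_ideal_component)
    ultimately have "component (a + b) (f * g) - (\<Sum>i\<in>{..a+b} - {b}. ?t i) \<in> p"
      by (intro ideal.subspace_diff[OF sub])
    then have "?t b \<in> p"
      unfolding split by simp
    then show False
      using prime[of "component a f" a "component b g" b] a b by simp
  qed
  then show ?thesis
    using sub ne by (auto simp: prime_ideal_def)
qed

text \<open>An ideal that is maximal among the homogeneous ideals disjoint from \<open>M\<close> is prime: when \<open>f\<close>
  and \<open>g\<close> are forms outside it, then it contains elements of \<open>M\<close> modulo \<open>f\<close> and modulo \<open>g\<close>, hence
  their product modulo \<open>f * g\<close>.\<close>

lemma homogeneous_prime_avoiding:
  assumes J: "homogeneous_ideal J" and one: "1 \<in> M"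
    and mult: "\<And>x y. x \<in> M \<Longrightarrow> y \<in> M \<Longrightarrow> x * y \<in> M" and disj: "J \<inter> M = {}"
  obtains p where "homogeneous_ideal p" "prime_ideal p" "J \<subseteq> p" "p \<inter> M = {}"
proof -
  let ?A = "{p. homogeneous_ideal p \<and> J \<subseteq> p \<and> p \<inter> M = {}}"
  have "\<exists>p\<in>?A. \<forall>X\<in>?A. p \<subseteq> X \<longrightarrow> X = p"
  proof (rule subset_Zorn_nonempty)
    show "?A \<noteq> {}"
      using J disj by blast
  next
    fix C assume ne: "C \<noteq> {}" and C: "subset.chain ?A C"
    have lin: "X \<subseteq> Y \<or> Y \<subseteq> X" if "X \<in> C" "Y \<in> C" for X Y
      using C that by (auto simp: subset_chain_def)
    have hom: "homogeneous_ideal X" "J \<subseteq> X" "X \<inter> M = {}" if "X \<in> C" for X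
      using C that by (auto simp: subset_chain_def)
    have "ideal.subspace (\<Union>C)"
      unfolding ideal.subspace_def
    proof (intro conjI ballI allI)
      show "0 \<in> \<Union>C"
        using ne hom(1) by (metis UnionI equals0I homogeneous_idealD ideal.subspace_0)
    next
      fix x y assume "x \<in> \<Union>C" "y \<in> \<Union>C"
      then obtain X where "X \<in> C" "x \<in> X" "y \<in> X"
        using lin by blast
      then show "x + y \<in> \<Union>C"
        by (meson UnionI hom(1) homogeneous_idealD ideal.subspace_add)
    next
      fix c x assume "x \<in> \<Union>C"
      then show "c * x \<in> \<Union>C"
        by (meson UnionE UnionI hom(1) homogeneous_idealD ideal.subspace_scale)
    qed
    then have "homogeneous_ideal (\<Union>C)"
      by (rule homogeneous_idealI) (meson UnionE UnionI hom(1) homogeneous_ideal_component)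
    then show "\<Union>C \<in> ?A"
      using ne hom(2,3) by blast
  qed
  then obtain p where p: "homogeneous_ideal p" "J \<subseteq> p" "p \<inter> M = {}"
    and max': "\<forall>X\<in>?A. p \<subseteq> X \<longrightarrow> X = p"
    by blast
  have max: "X = p" if "homogeneous_ideal X" "p \<subseteq> X" "X \<inter> M = {}" for X
    using max' that p(2) by blast
  have sub: "ideal.subspace p"
    using p by (simp add: homogeneous_idealD)
  have meet: "\<exists>x\<in>M. \<exists>k. x - k * f \<in> p" if f: "f \<in> forms d" "f \<notin> p" for f d
  proof -
    let ?X = "insert f (p \<inter> (\<Union>d. forms d))"
    have X: "homogeneous_ideal (ideal.span ?X)"
      using f by (intro homogeneous_ideal_span) auto
    have span_p: "ideal.span (p \<inter> (\<Union>d. forms d)) = p"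
      using p by (simp add: homogeneous_ideal_def)
    have "p \<subseteq> ideal.span ?X"
      using span_p by (metis ideal.span_mono subset_insertI)
    moreover have "f \<in> ideal.span ?X"
      by (simp add: ideal.span_base)
    ultimately have "ideal.span ?X \<inter> M \<noteq> {}"
      using max[OF X] f by blast
    then obtain x where "x \<in> M" "x \<in> ideal.span ?X"
      by blast
    then show ?thesis
      unfolding ideal.span_insert span_p by blast
  qed
  have "prime_ideal p"
  proof (rule homogeneous_prime_idealI)
    show "homogeneous_ideal p"
      by (fact p)
    show "1 \<notin> p"
      using p one by blast
    fix f g d e assume f: "f \<in> forms d" and g: "g \<in> forms e" and fg: "f * g \<in> p"
    show "f \<in> p \<or> g \<in> p"
    proof (rule ccontr)
      assume "\<not> ?thesis"
      then obtain x k y l where x: "x \<in> M" "x - k * f \<in> p" and y: "y \<in> M" "y - l * g \<in> p"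
        using meet[OF f] meet[OF g] by blast
      have "x * y = y * (x - k * f) + (k * f) * (y - l * g) + (k * l) * (f * g)"
        by (simp add: algebra_simps)
      also have "\<dots> \<in> p"
        using x y fg by (meson ideal.subspace_add[OF sub] ideal.subspace_scale[OF sub])
      finally show False
        using mult[OF x(1) y(1)] p by blast
    qed
  qed
  then show thesis
    using that p by blast
qed

section \<open>Points of projective schemes\<close>

lemma sum_single: "(\<Sum>m\<in>Poly_Mapping.keys f. Poly_Mapping.single m (Poly_Mapping.lookup f m)) = f"
  by (rule poly_mapping_eqI) (auto simp: lookup_sum lookup_single when_def in_keys_iff)

lemma const_mult_single: "const c * Poly_Mapping.single m a = Poly_Mapping.single m (c * a)"
  by (simp add: const_def mult_single)

lemma var_power: "var v ^ e = Poly_Mapping.single (Poly_Mapping.single v e) 1"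
  by (induction e) (auto simp: var_def mult_single simp flip: single_add)

lemma forms_Suc_cases:
  assumes "f \<in> forms (Suc d)"
  obtains g where "\<And>v. g v \<in> forms d" "f = (\<Sum>v\<in>UNIV. var v * g v)"
proof -
  let ?P = "\<lambda>f. \<exists>g. (\<forall>v. g v \<in> forms d) \<and> f = (\<Sum>v\<in>UNIV. var v * g v)"
  have mono: "?P (Poly_Mapping.single m c)" if m: "mdeg m = Suc d" for m :: "'a \<Rightarrow>\<^sub>0 nat" and c
  proof -
    obtain w where w: "Poly_Mapping.lookup m w \<noteq> 0"
      using m by (metis mdeg_def sum.neutral nat.distinct(1))
    let ?m = "m - Poly_Mapping.single w 1"
    have m_eq: "m = Poly_Mapping.single w 1 + ?m"
      using w by (intro poly_mapping_eqI) (auto simp: lookup_add lookup_minus lookup_single when_def)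
    then have "mdeg m = 1 + mdeg ?m"
      by (metis mdeg_add mdeg_single)
    then have "Poly_Mapping.single ?m c \<in> forms d"
      using m by (simp add: forms_iff lookup_single when_def)
    moreover have "Poly_Mapping.single m c = var w * Poly_Mapping.single ?m c"
      using m_eq by (simp add: var_def mult_single)
    ultimately show ?thesis
      by (intro exI[of _ "\<lambda>v. if v = w then Poly_Mapping.single ?m c else 0"])
        (auto simp: if_distrib cong: if_cong)
  qed
  have "?P (sum (\<lambda>m. Poly_Mapping.single m (Poly_Mapping.lookup f m)) S)"
    if "S \<subseteq> Poly_Mapping.keys f" for S
    using finite_subset[OF that finite_keys] that
  proof (induction S rule: finite_induct)
    case empty
    show ?case
      by (auto intro!: exI[of _ "\<lambda>_. 0"])
  next
    case (insert m S)
    then obtain g where g: "\<forall>v. g v \<in> forms d"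
        "sum (\<lambda>m. Poly_Mapping.single m (Poly_Mapping.lookup f m)) S = (\<Sum>v\<in>UNIV. var v * g v)"
      by auto
    have "mdeg m = Suc d"
      using insert.prems assms by (auto simp: forms_iff in_keys_iff)
    then obtain h where h: "\<forall>v. h v \<in> forms d"
        "Poly_Mapping.single m (Poly_Mapping.lookup f m) = (\<Sum>v\<in>UNIV. var v * h v)"
      using mono by blast
    show ?case
      using insert.hyps g h
      by (auto intro!: exI[of _ "\<lambda>v. h v + g v"] simp: forms_add distrib_left sum.distrib)
  qed
  from this[OF order_refl] show thesis
    using that unfolding sum_single by blast
qed

lemma finite_monomials: "finite {m :: 'v::finite \<Rightarrow>\<^sub>0 nat. mdeg m = d}"
proof -
  have "Poly_Mapping.lookup ` {m :: 'v \<Rightarrow>\<^sub>0 nat. mdeg m = d} \<subseteq> Pi\<^sub>E UNIV (\<lambda>_. {..d})"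
    by (auto simp: mdeg_def intro: member_le_sum)
  then have "finite (Poly_Mapping.lookup ` {m :: 'v \<Rightarrow>\<^sub>0 nat. mdeg m = d})"
    by (rule finite_subset) (simp add: finite_PiE)
  then show ?thesis
    by (rule finite_imageD) (auto simp: inj_on_def lookup_inject)
qed

lemma prime_ideal_power: "prime_ideal p \<Longrightarrow> t ^ e \<in> p \<Longrightarrow> t \<in> p"
proof (induction e)
  case 0
  then have "p = UNIV"
    using ideal.subspace_scale[of p 1] by (auto simp: prime_ideal_def)
  then show ?case
    using 0 by (simp add: prime_ideal_def)
qed (auto simp: prime_ideal_def)

lemma prime_ideal_prod:
  assumes "prime_ideal p" "finite A" "prod f A \<in> p"
  shows "\<exists>a\<in>A. f a \<in> p"
  using assms(2,3)
proof (induction A rule: finite_induct)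
  case empty
  then show ?case
    using prime_ideal_power[OF assms(1), of _ 0] assms(1) ideal.subspace_0
    by (metis UNIV_eq_I power_0 prime_ideal_def prod.empty)
next
  case (insert x F)
  then show ?case
    using assms(1) by (auto simp: prime_ideal_def)
qed

lemma const_mult_mem:
  assumes "ideal.subspace p" "const c * f \<in> p" "c \<noteq> 0"
  shows "f \<in> p"
proof -
  have "const (inverse c) * (const c * f) \<in> p"
    by (rule ideal.subspace_scale) fact+
  then show ?thesis
    using assms(3) by (simp flip: const_mult mult.assoc)
qed

lemma proj_pointsD:
  assumes "p \<in> proj_points J"
  shows "homogeneous_ideal p" "prime_ideal p" "ideal.subspace p" "J \<subseteq> p" "\<not> forms 1 \<subseteq> p" "1 \<notin> p"
proof -
  show *: "homogeneous_ideal p" "prime_ideal p" "ideal.subspace p" "J \<subseteq> p" "\<not> forms 1 \<subseteq> p"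
    using assms by (auto simp: proj_points_def prime_ideal_def)
  show "1 \<notin> p"
    using prime_ideal_power[OF *(2), of _ 0] *(5) by auto
qed

text \<open>The projective Nullstellensatz for the empty set. A point exists as soon as no power of some
  variable lies in \<open>J\<close>; otherwise a form of high degree lies in \<open>J\<close> because each of its monomials
  is divisible by a high power of a variable.\<close>

lemma proj_points_empty:
  fixes J :: "('v::finite) rpoly set"
  assumes J: "homogeneous_ideal J" and empty: "proj_points J = {}"
  obtains N where "forms N \<subseteq> J"
proof -
  have "\<forall>\<^sub>F e in sequentially. \<forall>v\<in>UNIV. var v ^ e \<in> J"
  proof (rule eventually_ball_finite)
    show "\<forall>v\<in>UNIV. \<forall>\<^sub>F e in sequentially. var v ^ e \<in> J"
    proof
      fix v :: 'v
      have "\<exists>e. var v ^ e \<in> J"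
      proof (rule ccontr)
        assume none: "\<not> ?thesis"
        obtain p where p: "homogeneous_ideal p" "prime_ideal p" "J \<subseteq> p" "p \<inter> range (\<lambda>e. var v ^ e) = {}"
        proof (rule homogeneous_prime_avoiding[OF J, where M = "range (\<lambda>e. var v ^ e)"])
          show "1 \<in> range (\<lambda>e. var v ^ e)"
            by (rule range_eqI[of _ _ 0]) simp
          show "x * y \<in> range (\<lambda>e. var v ^ e)"
            if "x \<in> range (\<lambda>e. var v ^ e)" "y \<in> range (\<lambda>e. var v ^ e)" for x y :: "'v rpoly"
            using that by (auto simp flip: power_add)
        qed (use none in auto)
        then have "var v \<notin> p"
          by (metis disjoint_iff power_one_right rangeI)
        then have "p \<in> proj_points J"
          using p var_in_forms[of v] by (auto simp: proj_points_def simp del: var_in_forms One_nat_def)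
        then show False
          using empty by blast
      qed
      then obtain e where e: "var v ^ e \<in> J" ..
      have "var v ^ n \<in> J" if "n \<ge> e" for n
        using ideal.subspace_scale[OF homogeneous_idealD[OF J] e, of "var v ^ (n - e)"] that
        by (simp flip: power_add)
      then show "\<forall>\<^sub>F e in sequentially. var v ^ e \<in> J"
        by (auto simp: eventually_sequentially)
    qed
  qed auto
  then obtain e where e: "\<And>v. var v ^ e \<in> J"
    by (auto simp: eventually_sequentially)
  have sub: "ideal.subspace J"
    using J by (rule homogeneous_idealD)
  have "f \<in> J" if f: "f \<in> forms (CARD('v) * e)" for f
  proof -
    have "Poly_Mapping.single m c \<in> J" if m: "mdeg m = CARD('v) * e" for m c
    proof -
      \<comment> \<open>The exponents of a monomial of this degree cannot all be less than \<open>e\<close>.\<close>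
      obtain v where v: "Poly_Mapping.lookup m v \<ge> e"
      proof (rule ccontr)
        assume "\<not> thesis"
        then have "Poly_Mapping.lookup m v < e" for v
          using that[of v] by fastforce
        then have "mdeg m < (\<Sum>v\<in>(UNIV :: 'v set). e)"
          unfolding mdeg_def by (intro sum_strict_mono) auto
        then show False
          using m by simp
      qed
      let ?m = "m - Poly_Mapping.single v e"
      have "m = ?m + Poly_Mapping.single v e"
        using v by (intro poly_mapping_eqI) (auto simp: lookup_add lookup_minus lookup_single when_def)
      then have "Poly_Mapping.single m c = Poly_Mapping.single ?m c * var v ^ e"
        by (simp add: var_power mult_single)
      then show ?thesis
        using ideal.subspace_scale[OF sub e] by simp
    qed
    then have "(\<Sum>m\<in>Poly_Mapping.keys f. Poly_Mapping.single m (Poly_Mapping.lookup f m)) \<in> J"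
      using f by (intro ideal.subspace_sum[OF sub]) (auto simp: forms_iff in_keys_iff)
    then show ?thesis
      by (simp add: sum_single)
  qed
  then show thesis
    using that by blast
qed

lemma homogeneous_ideal_colon:
  assumes J: "homogeneous_ideal J" and f: "f \<in> forms d"
  shows "homogeneous_ideal {g. g * f \<in> J}"
proof (rule homogeneous_idealI)
  have sub: "ideal.subspace J"
    using J by (rule homogeneous_idealD)
  show "ideal.subspace {g. g * f \<in> J}"
    unfolding ideal.subspace_def
    using ideal.subspace_0[OF sub] ideal.subspace_add[OF sub] ideal.subspace_scale[OF sub]
    by (auto simp: distrib_right mult.assoc)
  fix g e assume "g \<in> {g. g * f \<in> J}"
  then have "component (e + d) (g * f) \<in> J"
    using J by (auto intro: homogeneous_ideal_component)
  then show "component e g \<in> {g. g * f \<in> J}"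
    by (simp add: component_mult_form[OF f])
qed

text \<open>A section that vanishes near every point is zero: a prime ideal that contains the quotient
  ideal \<open>(J : f)\<close> and no power of \<open>t\<close> would be a point where \<open>f\<close> is not locally zero.\<close>

lemma power_mult_mem_if_locally_zero:
  assumes J: "homogeneous_ideal J" and t: "t \<in> forms 1" and f: "f \<in> forms d"
    and loc: "\<And>p. p \<in> proj_points J \<Longrightarrow> \<exists>s. s \<notin> p \<and> s * f \<in> J"
  obtains e where "t ^ e * f \<in> J"
proof -
  have "\<exists>e. t ^ e * f \<in> J"
  proof (rule ccontr)
    assume none: "\<not> ?thesis"
    obtain p where p: "homogeneous_ideal p" "prime_ideal p" "{g. g * f \<in> J} \<subseteq> p"
      "p \<inter> range (\<lambda>e. t ^ e) = {}"
    proof (rule homogeneous_prime_avoiding[OF homogeneous_ideal_colon[OF J f], where M = "range (\<lambda>e. t ^ e)"])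
      show "1 \<in> range (\<lambda>e. t ^ e)"
        by (rule range_eqI[of _ _ 0]) simp
      show "x * y \<in> range (\<lambda>e. t ^ e)"
        if "x \<in> range (\<lambda>e. t ^ e)" "y \<in> range (\<lambda>e. t ^ e)" for x y
        using that by (auto simp flip: power_add)
    qed (use none in auto)
    then have "t \<notin> p"
      by (metis disjoint_iff power_one_right rangeI)
    moreover have "J \<subseteq> p"
      using p(3) ideal.subspace_scale[OF homogeneous_idealD[OF J]] by (auto simp: mult.commute)
    ultimately have "p \<in> proj_points J"
      using p t by (auto simp: proj_points_def)
    then show False
      using loc p(3) by blast
  qed
  then show thesis
    using that by blast
qed

text \<open>The multiplicative set generated by \<open>t\<close> and all forms \<open>l - c t\<close> has no point in its
  complement and therefore meets \<open>J\<close>. An element of \<open>J\<close> of this shape has finitely many factors,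
  and the value of \<open>l / t\<close> at each point is given by one of them.\<close>

lemma finitely_many_values:
  assumes J: "homogeneous_ideal J" and t: "t \<in> forms 1"
    and val: "\<And>p. p \<in> proj_points J \<Longrightarrow> t \<notin> p \<and> (\<exists>c. l - const c * t \<in> p)"
  obtains A where "finite A" "\<And>p. p \<in> proj_points J \<Longrightarrow> \<exists>c\<in>A. l - const c * t \<in> p"
proof -
  let ?x = "\<lambda>e cs. t ^ e * (\<Prod>c\<leftarrow>cs. l - const c * t)"
  let ?M = "{?x e cs | e cs. True}"
  have "J \<inter> ?M \<noteq> {}"
  proof
    assume disj: "J \<inter> ?M = {}"
    obtain p where p: "homogeneous_ideal p" "prime_ideal p" "J \<subseteq> p" "p \<inter> ?M = {}"
    proof (rule homogeneous_prime_avoiding[OF J _ _ disj])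
      have "1 = ?x 0 []"
        by simp
      then show "1 \<in> ?M"
        by blast
      fix x y assume "x \<in> ?M" "y \<in> ?M"
      then obtain e cs e' cs' where "x = ?x e cs" "y = ?x e' cs'"
        by blast
      then have "x * y = ?x (e + e') (cs @ cs')"
        by (simp add: power_add mult_ac)
      then show "x * y \<in> ?M"
        by blast
    qed
    have "?x 1 [] \<notin> p"
      using p(4) by blast
    then have "t \<notin> p"
      by simp
    then have "p \<in> proj_points J"
      using p t by (auto simp: proj_points_def)
    then obtain c where "l - const c * t \<in> p"
      using val by blast
    then have "?x 0 [c] \<in> p"
      by simp
    then show False
      using p(4) by blast
  qed
  then obtain e cs where x: "?x e cs \<in> J"
    by blast
  have "\<exists>c\<in>set cs. l - const c * t \<in> p" if p: "p \<in> proj_points J" for p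
  proof -
    have pr: "prime_ideal p"
      using p proj_pointsD by blast
    have "t ^ e \<notin> p"
      using val[OF p] prime_ideal_power[OF pr] by blast
    then have "(\<Prod>c\<leftarrow>cs. l - const c * t) \<in> p"
      using x proj_pointsD(4)[OF p] pr by (auto simp: prime_ideal_def)
    then show ?thesis
    proof (induction cs)
      case Nil
      then show ?case
        using proj_pointsD(6)[OF p] by simp
    next
      case (Cons c cs)
      then show ?case
        using pr by (auto simp: prime_ideal_def)
    qed
  qed
  then show thesis
    using that[of "set cs"] by auto
qed

text \<open>At a point where the coordinates have real values relative to \<open>t\<close>, every form has a real
  value relative to a power of \<open>t\<close>.\<close>

lemma form_mod_power:
  fixes q :: "('a::finite) rpoly set"
  assumes q: "ideal.subspace q" and var: "\<And>v. \<exists>c. var v - const c * t \<in> q" and f: "f \<in> forms d"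
  shows "\<exists>c. f - const c * t ^ d \<in> q"
  using f
proof (induction d arbitrary: f)
  case 0
  have "f = const (Poly_Mapping.lookup f 0)"
  proof (rule poly_mapping_eqI)
    fix m :: "'a \<Rightarrow>\<^sub>0 nat"
    have "m = 0" if "mdeg m = 0"
      using that by (intro poly_mapping_eqI) (auto simp: mdeg_def)
    then show "Poly_Mapping.lookup f m = Poly_Mapping.lookup (const (Poly_Mapping.lookup f 0)) m"
      using 0 by (auto simp: const_def lookup_single when_def forms_iff)
  qed
  then show ?case
    using ideal.subspace_0[OF q] by (intro exI[of _ "Poly_Mapping.lookup f 0"]) simp
next
  case (Suc d)
  obtain g where g: "\<And>v. g v \<in> forms d" "f = (\<Sum>v\<in>UNIV. var v * g v)"
    using forms_Suc_cases[OF Suc.prems] by metis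
  obtain c where c: "\<And>v. var v - const (c v) * t \<in> q"
    using var by metis
  have "\<forall>v. \<exists>e. g v - const e * t ^ d \<in> q"
    using Suc.IH g(1) by blast
  then obtain e where e: "\<And>v. g v - const (e v) * t ^ d \<in> q"
    by metis
  have "f - const (\<Sum>v\<in>UNIV. c v * e v) * t ^ Suc d
      = (\<Sum>v\<in>UNIV. var v * g v - const (c v * e v) * t ^ Suc d)"
    by (simp add: g(2) const_sum sum_distrib_right sum_subtractf)
  also have "\<dots> = (\<Sum>v\<in>UNIV. g v * (var v - const (c v) * t) +
      (const (c v) * t) * (g v - const (e v) * t ^ d))"
    by (rule sum.cong) (simp_all add: algebra_simps const_mult)
  also have "\<dots> \<in> q"
    by (intro ideal.subspace_sum[OF q] ideal.subspace_add[OF q])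
      (rule ideal.subspace_scale[OF q c] ideal.subspace_scale[OF q e])+
  finally show ?case
    by blast
qed

lemma linear_form_mod:
  assumes q: "ideal.subspace q" and x: "\<And>v. var v - const (x $ v) * t \<in> q"
  shows "linear_form a - const (inner a x) * t \<in> q"
proof -
  have "linear_form a - const (inner a x) * t = (\<Sum>v\<in>UNIV. const (a $ v) * (var v - const (x $ v) * t))"
    by (simp add: linear_form_def inner_vec_def const_sum sum_distrib_right
        const_mult right_diff_distrib sum_subtractf mult.assoc)
  also have "\<dots> \<in> q"
    by (intro ideal.subspace_sum[OF q] ideal.subspace_scale[OF q x])
  finally show ?thesis .
qed

lemma point_unique:
  assumes p: "p \<in> proj_points J" "t \<notin> p" and q: "q \<in> proj_points J" "t \<notin> q"
    and eq: "\<And>v. var v - const (c v) * t \<in> p" "\<And>v. var v - const (c v) * t \<in> q"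
  shows "p = q"
proof -
  have "p \<subseteq> q" if p: "p \<in> proj_points J" "t \<notin> p" and q: "q \<in> proj_points J"
    and eq: "\<And>v. var v - const (c v) * t \<in> p" "\<And>v. var v - const (c v) * t \<in> q" for p q
  proof
    fix f assume f: "f \<in> p"
    note P = proj_pointsD[OF p(1)] and Q = proj_pointsD[OF q]
    have "component d f \<in> q" for d
    proof -
      have sub: "ideal.subspace (p \<inter> q)"
        using P(3) Q(3) by (rule ideal.subspace_inter)
      obtain k where k: "component d f - const k * t ^ d \<in> p \<inter> q"
        using form_mod_power[OF sub, of t "component d f" d] eq component_in_forms by blast
      have "component d f \<in> p"
        using homogeneous_ideal_component[OF P(1) f] .
      then have "const k * t ^ d \<in> p"
        using ideal.subspace_diff[OF P(3), of "component d f" "component d f - const k * t ^ d"] k by simp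
      then have "k = 0"
        using const_mult_mem[OF P(3)] prime_ideal_power[OF P(2)] p(2) by blast
      then show ?thesis
        using k by simp
    qed
    then show "f \<in> q"
      by (rule mem_if_components[OF Q(3)])
  qed
  then show ?thesis
    using p q eq by blast
qed

text \<open>A vector that is not orthogonal to the nonzero differences of elements of \<open>X\<close> is found by
  induction over these differences, moving the vector slightly in the direction of a new
  difference.\<close>

lemma ex_separating_functional:
  fixes X :: "('a::real_inner) set"
  assumes "finite X"
  obtains a where "inj_on (\<lambda>x. inner a x) X"
proof -
  have "\<exists>a. \<forall>z\<in>Z. inner a z \<noteq> 0" if "finite Z" "0 \<notin> Z" for Z :: "'a set"
    using that
  proof (induction Z rule: finite_induct)
    case (insert z Z)
    then obtain a where a: "\<forall>z\<in>Z. inner a z \<noteq> 0"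
      by auto
    have "finite (insert 0 (insert (- inner a z / inner z z) ((\<lambda>w. - inner a w / inner z w) ` Z)))"
      using insert by simp
    then obtain r where r: "r \<notin> insert 0 (insert (- inner a z / inner z z) ((\<lambda>w. - inner a w / inner z w) ` Z))"
      using ex_new_if_finite[OF infinite_UNIV_char_0] by blast
    have "inner (a + r *\<^sub>R z) w \<noteq> 0" if "w \<in> insert z Z" for w
    proof (cases "inner z w = 0")
      case True
      then have "w \<in> Z"
        using that insert.prems by auto
      then show ?thesis
        using True a by (simp add: inner_left_distrib)
    next
      case False
      have "r \<noteq> - inner a w / inner z w"
        using r that by auto
      then show ?thesis
        using False by (auto simp: inner_left_distrib field_simps add_eq_0_iff2)
    qed
    then show ?case
      by blast
  qed auto
  from this[of "(\<lambda>(x, y). x - y) ` (X \<times> X) - {0}"] obtain a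
    where "\<And>x y. x \<in> X \<Longrightarrow> y \<in> X \<Longrightarrow> x \<noteq> y \<Longrightarrow> inner a (x - y) \<noteq> 0"
    using assms by fastforce
  then have "inj_on (\<lambda>x. inner a x) X"
    by (intro inj_onI) (metis inner_diff_right right_minus_eq)
  then show thesis
    using that by blast
qed

lemma ex_interpolation_poly:
  fixes g :: "real \<Rightarrow> real"
  assumes "finite A"
  shows "\<exists>c. (\<forall>i\<ge>card A. coeff c i = 0) \<and> (\<forall>a\<in>A. poly c a = g a)"
  using assms
proof (induction A rule: finite_induct)
  case empty
  show ?case
    by (auto intro: exI[of _ 0])
next
  case (insert a A)
  then obtain c where c: "\<forall>i\<ge>card A. coeff c i = 0" "\<forall>a\<in>A. poly c a = g a"
    by blast
  define F where "F = (\<Prod>b\<in>A. [:-b, 1:])"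
  have F: "poly F a \<noteq> 0" "\<And>b. b \<in> A \<Longrightarrow> poly F b = 0"
    using insert by (auto simp: F_def poly_prod)
  have "degree F = card A"
    by (simp add: F_def degree_prod_eq_sum_degree)
  then have "\<forall>i\<ge>card (insert a A). coeff (c + smult ((g a - poly c a) / poly F a) F) i = 0"
    using c insert by (auto simp: coeff_eq_0)
  moreover have "\<forall>b\<in>insert a A. poly (c + smult ((g a - poly c a) / poly F a) F) b = g b"
    using c F by auto
  ultimately show ?case
    by blast
qed

section \<open>Split fibres\<close>

text \<open>Up to the power \<open>t ^ D\<close> this is the value of \<open>c\<close> at \<open>l / t\<close>; coefficients of \<open>c\<close> above \<open>D\<close>
  are ignored.\<close>

definition homogenization :: "('v::finite) rpoly \<Rightarrow> 'v rpoly \<Rightarrow> nat \<Rightarrow> real poly \<Rightarrow> 'v rpoly" where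
  "homogenization l t D c = (\<Sum>i\<le>D. const (coeff c i) * l ^ i * t ^ (D - i))"

lemma homogenization_0 [simp]: "homogenization l t D 0 = 0"
  by (simp add: homogenization_def)

lemma homogenization_add:
  "homogenization l t D (c + c') = homogenization l t D c + homogenization l t D c'"
  by (simp add: homogenization_def const_add distrib_right sum.distrib)

lemma homogenization_smult:
  "homogenization l t D (smult a c) = const a * homogenization l t D c"
  by (simp add: homogenization_def const_mult sum_distrib_left mult.assoc)

lemma homogenization_diff:
  "homogenization l t D (c - c') = homogenization l t D c - homogenization l t D c'"
  by (simp add: homogenization_def const_diff left_diff_distrib sum_subtractf)

lemma homogenization_sum:
  "homogenization l t D (sum c A) = (\<Sum>i\<in>A. homogenization l t D (c i))"
  by (induction A rule: infinite_finite_induct) (simp_all add: homogenization_add)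

lemma homogenization_pCons:
  "homogenization l t (Suc D) (pCons a c) = const a * t ^ Suc D + l * homogenization l t D c"
  unfolding homogenization_def sum.atMost_Suc_shift
  by (simp add: sum_distrib_left mult_ac)

lemma homogenization_Suc:
  assumes "degree c \<le> D"
  shows "homogenization l t (Suc D) c = t * homogenization l t D c"
  using assms
  by (simp add: homogenization_def coeff_eq_0 Suc_diff_le sum_distrib_left mult_ac)

lemma homogenization_add_degree:
  "degree c \<le> D \<Longrightarrow> homogenization l t (k + D) c = t ^ k * homogenization l t D c"
  by (induction k)
    (simp_all add: homogenization_Suc mult.assoc)

lemma homogenization_mult:
  assumes "degree c \<le> D" "degree c' \<le> D'"
  shows "homogenization l t (D + D') (c * c') = homogenization l t D c * homogenization l t D' c'"
  using assms(1)
proof (induction c arbitrary: D)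
  case 0
  then show ?case
    by simp
next
  case (pCons a c)
  show ?case
  proof (cases D)
    case 0
    then have "c = 0"
      using pCons by (auto split: if_splits)
    then show ?thesis
      using 0 by (simp add: homogenization_smult) (simp add: homogenization_def)
  next
    case (Suc E)
    then have "degree c \<le> E"
      using pCons by (auto split: if_splits)
    then have IH: "homogenization l t (E + D') (c * c')
        = homogenization l t E c * homogenization l t D' c'"
      by (rule pCons.IH)
    have "homogenization l t (D + D') (pCons a c * c')
        = const a * homogenization l t (Suc E + D') c'
          + homogenization l t (Suc (E + D')) (pCons 0 (c * c'))"
      using Suc by (simp add: homogenization_add homogenization_smult)
    also have "\<dots> = (const a * t ^ Suc E + l * homogenization l t E c) * homogenization l t D' c'"
      unfolding homogenization_add_degree[OF assms(2)] homogenization_pCons IH const_0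
      by (simp add: algebra_simps)
    finally show ?thesis
      unfolding Suc homogenization_pCons .
  qed
qed

lemma homogenization_in_forms:
  assumes "l \<in> forms 1" "t \<in> forms 1"
  shows "homogenization l t D c \<in> forms D"
  unfolding homogenization_def
proof (rule forms_sum)
  fix i assume "i \<in> {..D}"
  then have "0 + 1 * i + 1 * (D - i) = D"
    by simp
  then show "const (coeff c i) * l ^ i * t ^ (D - i) \<in> forms D"
    using forms_mult[OF forms_mult[OF const_in_forms forms_power[OF assms(1)]] forms_power[OF assms(2)]]
    by metis
qed

abbreviation root_poly :: "real set \<Rightarrow> real poly" where
  "root_poly A \<equiv> \<Prod>a\<in>A. [:- a, 1:]"

lemma degree_root_poly [simp]: "degree (root_poly A) = card A"
  by (simp add: degree_prod_eq_sum_degree)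

lemma homogenization_root_poly:
  assumes "finite A"
  shows "homogenization l t (card A) (root_poly A) = (\<Prod>a\<in>A. l - const a * t)"
  using assms
proof (induction A rule: finite_induct)
  case empty
  show ?case
    by (simp add: homogenization_def)
next
  case (insert a A)
  have "homogenization l t 1 [:- a, 1:] = l - const a * t"
    by (simp add: homogenization_def const_uminus del: ideal.scale_minus_left)
  then show ?case
    using insert homogenization_mult[of "[:- a, 1:]" 1 "root_poly A" "card A" l t]
    by simp
qed

text \<open>Substitution of the value \<open>a\<close> for \<open>l / t\<close>.\<close>

lemma homogenization_mod:
  assumes q: "ideal.subspace q" and l: "l - const a * t \<in> q" and D: "degree c \<le> D"
  shows "homogenization l t D c - const (poly c a) * t ^ D \<in> q"
proof -
  have "poly c a = (\<Sum>i\<le>D. coeff c i * a ^ i)"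
    unfolding poly_altdef using D by (intro sum.mono_neutral_left) (auto simp: coeff_eq_0)
  then have "homogenization l t D c - const (poly c a) * t ^ D
      = (\<Sum>i\<le>D. const (coeff c i) * l ^ i * t ^ (D - i) - const (coeff c i * a ^ i) * t ^ D)"
    by (simp add: homogenization_def const_sum sum_distrib_right sum_subtractf)
  also have "\<dots> \<in> q"
  proof (rule ideal.subspace_sum[OF q])
    fix i assume "i \<in> {..D}"
    then have t: "t ^ D = t ^ i * t ^ (D - i)"
      by (simp flip: power_add)
    have ca: "const (a ^ i) = const a ^ i"
      by (induction i) (simp_all add: const_mult)
    have "l ^ i - (const a * t) ^ i
        = (\<Sum>j<i. (const a * t) ^ (i - Suc j) * l ^ j) * (l - const a * t)"
      using power_diff_sumr2[of l i "const a * t"] by (simp add: mult_ac)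
    also have "\<dots> \<in> q"
      using l by (rule ideal.subspace_scale[OF q])
    finally have "(const (coeff c i) * t ^ (D - i)) * (l ^ i - (const a * t) ^ i) \<in> q"
      by (rule ideal.subspace_scale[OF q])
    moreover have "(const (coeff c i) * t ^ (D - i)) * (l ^ i - (const a * t) ^ i)
       = const (coeff c i) * l ^ i * t ^ (D - i) - const (coeff c i * a ^ i) * t ^ D"
      unfolding t const_mult ca
      by (simp add: algebra_simps power_mult_distrib)
    ultimately show "const (coeff c i) * l ^ i * t ^ (D - i) - const (coeff c i * a ^ i) * t ^ D \<in> q"
      by simp
  qed
  finally show ?thesis .
qed

text \<open>For \<open>t\<close> without zeros, this expresses in degree \<open>D\<close> that the algebra of the fractions
  \<open>f / t ^ e\<close> of degree zero, modulo \<open>J\<close>, is a quotient of \<open>\<real>[T]/(\<Prod>a\<in>A. T - a)\<close> through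
  \<open>T \<mapsto> l / t\<close>. All conditions are in degree \<open>D\<close>, so they can be read off from the degree \<open>D\<close> part
  of \<open>J\<close>. The set \<open>A\<close> may be larger than the set of values of \<open>l / t\<close> at the points; the number of
  points can drop under perturbation.\<close>

definition splits :: "('v::finite) rpoly set \<Rightarrow> 'v rpoly \<Rightarrow> nat \<Rightarrow> 'v rpoly \<Rightarrow> real set \<Rightarrow> bool" where
  "splits J t D l A \<longleftrightarrow> finite A \<and> card A \<le> D \<and> homogenization l t D (root_poly A) \<in> J \<and>
    (\<forall>f\<in>forms D. \<exists>c. (\<forall>i\<ge>card A. coeff c i = 0) \<and> f - homogenization l t D c \<in> J)"

lemma degree_le_if_coeff_eq_0: "(\<forall>i\<ge>m. coeff c i = 0) \<Longrightarrow> m \<le> Suc D \<Longrightarrow> degree c \<le> D"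
  by (rule degree_le) auto

lemma splits_Suc:
  assumes J: "ideal.subspace J" and t: "t \<in> forms 1" and l: "l \<in> forms 1" and s: "splits J t D l A"
  shows "splits J t (Suc D) l A"
proof -
  have A: "finite A" "card A \<le> D" "homogenization l t D (root_poly A) \<in> J"
    and span: "\<And>f. f \<in> forms D \<Longrightarrow> \<exists>c. (\<forall>i\<ge>card A. coeff c i = 0) \<and> f - homogenization l t D c \<in> J"
    using s by (auto simp: splits_def)
  \<comment> \<open>A product of a variable and \<open>l ^ i * t ^ (D - i)\<close> still contains a factor \<open>t\<close> when
    \<open>i < card A\<close>, as \<open>card A \<le> D\<close>; so it is \<open>t\<close> times a form of degree \<open>D\<close>.\<close>
  have step: "\<exists>c. (\<forall>i\<ge>card A. coeff c i = 0) \<and> x * g - homogenization l t (Suc D) c \<in> J"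
    if x: "x \<in> forms 1" and g: "g \<in> forms D" for x g
  proof -
    obtain c where c: "\<forall>i\<ge>card A. coeff c i = 0" "g - homogenization l t D c \<in> J"
      using span[OF g] by blast
    have xg: "x * g - x * homogenization l t D c \<in> J"
      using ideal.subspace_scale[OF J c(2), of x] by (simp add: right_diff_distrib)
    show ?thesis
    proof (cases D)
      case 0
      then have "c = 0"
        using A c by (intro poly_eqI) auto
      then show ?thesis
        using xg by (intro exI[of _ 0]) simp
    next
      case (Suc E)
      then have "degree c \<le> E"
        using A c by (intro degree_le_if_coeff_eq_0) auto
      then have c': "homogenization l t D c = t * homogenization l t E c"
        using Suc by (simp add: homogenization_Suc)
      have "x * homogenization l t E c \<in> forms D"
        using forms_mult[OF x homogenization_in_forms[OF l t]] Suc by simp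
      then obtain b where b: "\<forall>i\<ge>card A. coeff b i = 0"
        "x * homogenization l t E c - homogenization l t D b \<in> J"
        using span by blast
      have "degree b \<le> D"
        using A b by (intro degree_le_if_coeff_eq_0) auto
      then have "t * (x * homogenization l t E c - homogenization l t D b)
          = x * homogenization l t D c - homogenization l t (Suc D) b"
        by (simp add: c' homogenization_Suc algebra_simps)
      then have "x * homogenization l t D c - homogenization l t (Suc D) b \<in> J"
        using ideal.subspace_scale[OF J b(2), of t] by simp
      then have "x * g - homogenization l t (Suc D) b \<in> J"
        using ideal.subspace_add[OF J xg] by fastforce
      then show ?thesis
        using b by blast
    qed
  qed
  have "\<exists>c. (\<forall>i\<ge>card A. coeff c i = 0) \<and> f - homogenization l t (Suc D) c \<in> J"
    if f: "f \<in> forms (Suc D)" for f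
  proof -
    obtain g where g: "\<And>v. g v \<in> forms D" "f = (\<Sum>v\<in>UNIV. var v * g v)"
      using forms_Suc_cases[OF f] by metis
    have "\<forall>v. \<exists>c. (\<forall>i\<ge>card A. coeff c i = 0) \<and> var v * g v - homogenization l t (Suc D) c \<in> J"
      using step[OF var_in_forms g(1)] by blast
    then obtain c where c: "\<And>v. \<forall>i\<ge>card A. coeff (c v) i = 0"
      "\<And>v. var v * g v - homogenization l t (Suc D) (c v) \<in> J"
      by metis
    have "f - homogenization l t (Suc D) (\<Sum>v\<in>UNIV. c v)
        = (\<Sum>v\<in>UNIV. var v * g v - homogenization l t (Suc D) (c v))"
      by (simp add: g(2) homogenization_sum sum_subtractf)
    also have "\<dots> \<in> J"
      by (intro ideal.subspace_sum[OF J] c)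
    finally show ?thesis
      using c(1) by (intro exI[of _ "\<Sum>v\<in>UNIV. c v"]) (auto simp: coeff_sum)
  qed
  moreover have "homogenization l t (Suc D) (root_poly A) \<in> J"
    using A ideal.subspace_scale[OF J] by (simp add: homogenization_Suc)
  ultimately show ?thesis
    using A by (auto simp: splits_def)
qed

lemma splits_mono:
  assumes "ideal.subspace J" "t \<in> forms 1" "l \<in> forms 1" "splits J t D l A" "D \<le> D'"
  shows "splits J t D' l A"
  using assms(5,4) by (induction rule: dec_induct) (auto intro: splits_Suc assms)

text \<open>Up to a power of \<open>t\<close>, the form given by the roots is the product of the forms \<open>l - a t\<close>.\<close>

lemma splits_root:
  assumes s: "splits J t D l A" and p: "p \<in> proj_points J" "t \<notin> p"
  shows "\<exists>a\<in>A. l - const a * t \<in> p"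
proof -
  note P = proj_pointsD[OF p(1)]
  have A: "finite A" "card A \<le> D" "homogenization l t D (root_poly A) \<in> p"
    using s P(4) by (auto simp: splits_def)
  then have "t ^ (D - card A) * (\<Prod>a\<in>A. l - const a * t) \<in> p"
    using homogenization_add_degree[of "root_poly A" "card A" l t "D - card A"]
    by (simp add: homogenization_root_poly)
  then have "(\<Prod>a\<in>A. l - const a * t) \<in> p"
    using P(2) prime_ideal_power[OF P(2)] p(2) by (auto simp: prime_ideal_def)
  then show ?thesis
    using prime_ideal_prod[OF P(2) A(1)] by blast
qed

text \<open>At a point, \<open>l / t\<close> has a real value \<open>a\<close>, and modulo \<open>J\<close> every form is, up to a power of
  \<open>t\<close>, a polynomial in \<open>l\<close> and \<open>t\<close>.\<close>

lemma splits_real_point: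
  fixes J :: "('a::finite) rpoly set"
  assumes J: "ideal.subspace J" and t: "t \<in> forms 1" and l: "l \<in> forms 1"
    and s: "splits J t D l A" and p: "p \<in> proj_points J" "t \<notin> p"
  shows "real_point p"
proof -
  note P = proj_pointsD[OF p(1)]
  obtain a where a: "l - const a * t \<in> p"
    using splits_root[OF s p] by blast
  have tD: "t ^ e \<notin> p" for e
    using prime_ideal_power[OF P(2)] p(2) by blast
  have val: "\<exists>c. t ^ D * f - const c * t ^ (D + d) \<in> p" if f: "f \<in> forms d" for f d
  proof -
    have s': "splits J t (D + d) l A"
      using splits_mono[OF J t l s] by simp
    have "t ^ D * f \<in> forms (D + d)"
      using forms_mult[OF forms_power[OF t] f] by simp
    then obtain c where c: "\<forall>i\<ge>card A. coeff c i = 0" "t ^ D * f - homogenization l t (D + d) c \<in> J"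
      using s' unfolding splits_def by blast
    have "degree c \<le> D + d"
      using c(1) s' by (intro degree_le_if_coeff_eq_0) (auto simp: splits_def)
    then have "homogenization l t (D + d) c - const (poly c a) * t ^ (D + d) \<in> p"
      by (rule homogenization_mod[OF P(3) a])
    then have "t ^ D * f - const (poly c a) * t ^ (D + d) \<in> p"
      using ideal.subspace_add[OF P(3), of "t ^ D * f - homogenization l t (D + d) c"] c(2) P(4)
      by fastforce
    then show ?thesis
      by blast
  qed
  show ?thesis
    unfolding real_point_def
  proof (intro allI ballI)
    fix d and f g :: "'a rpoly" assume f: "f \<in> forms d" and g: "g \<in> forms d - p"
    obtain c c' where c: "t ^ D * f - const c * t ^ (D + d) \<in> p"
      and c': "t ^ D * g - const c' * t ^ (D + d) \<in> p"
      using val f g by blast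
    have "c' \<noteq> 0"
    proof
      assume "c' = 0"
      then have "t ^ D * g \<in> p"
        using c' by simp
      then show False
        using tD g P(2) by (auto simp: prime_ideal_def)
    qed
    then have "const c' * (const (c / c') * y) = const c * y" for y :: "'a rpoly"
      by (simp flip: const_mult mult.assoc)
    from this[of "t ^ (D + d)"] have "t ^ D * (f - const (c / c') * g) = (t ^ D * f - const c * t ^ (D + d))
        - const (c / c') * (t ^ D * g - const c' * t ^ (D + d))"
      by (simp add: right_diff_distrib mult.left_commute)
    also have "\<dots> \<in> p"
      by (intro ideal.subspace_diff[OF P(3)] c ideal.subspace_scale[OF P(3) c'])
    finally show "\<exists>c. f - const c * g \<in> p"
      using tD P(2) by (auto simp: prime_ideal_def)
  qed
qed

text \<open>In the algebra of the fibre, the product \<open>g\<close> of the factors \<open>l - b t\<close> for the other roots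
  \<open>b\<close> is invertible at the point with value \<open>a\<close>, and it is annihilated by \<open>l - a t\<close>. A form \<open>f\<close>
  that vanishes at the point is, modulo \<open>J\<close> and up to a power of \<open>t\<close>, a multiple of \<open>l - a t\<close>.\<close>

lemma splits_unramified:
  assumes J: "ideal.subspace J" and t: "t \<in> forms 1" and l: "l \<in> forms 1"
    and s: "splits J t D l A" and p: "p \<in> proj_points J" "t \<notin> p" and f: "f \<in> p \<inter> forms d"
  obtains e s where "s \<in> forms e - p" "s * f \<in> J"
proof -
  note P = proj_pointsD[OF p(1)]
  obtain a where a: "a \<in> A" "l - const a * t \<in> p"
    using splits_root[OF s p] by blast
  have A: "finite A" "card A \<le> D" "homogenization l t D (root_poly A) \<in> J"
    using s by (auto simp: splits_def)
  have tD: "t ^ e \<notin> p" for e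
    using prime_ideal_power[OF P(2)] p(2) by blast
  have s': "splits J t (D + d) l A"
    using splits_mono[OF J t l s] by simp
  have "t ^ D * f \<in> forms (D + d)"
    using forms_mult[OF forms_power[OF t], of f d] f by simp
  then obtain c where c: "\<forall>i\<ge>card A. coeff c i = 0" "t ^ D * f - homogenization l t (D + d) c \<in> J"
    using s' unfolding splits_def by blast
  have c_deg: "degree c \<le> D + d"
    using c(1) s' by (intro degree_le_if_coeff_eq_0) (auto simp: splits_def)
  have "t ^ D * f \<in> p"
    using ideal.subspace_scale[OF P(3)] f by blast
  moreover have "t ^ D * f - homogenization l t (D + d) c \<in> p"
    using c(2) P(4) by blast
  ultimately have "t ^ D * f - (t ^ D * f - homogenization l t (D + d) c) \<in> p"
    by (rule ideal.subspace_diff[OF P(3)])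
  then have "homogenization l t (D + d) c \<in> p"
    by simp
  from ideal.subspace_diff[OF P(3) this homogenization_mod[OF P(3) a(2) c_deg]]
  have "const (poly c a) * t ^ (D + d) \<in> p"
    by simp
  then have "poly c a = 0"
    using const_mult_mem[OF P(3)] tD by blast
  then obtain c' where c': "c = [:- a, 1:] * c'"
    by (auto simp: poly_eq_0_iff_dvd elim: dvdE)
  define A' where "A' = A - {a}"
  have A': "finite A'" "card A = Suc (card A')" "a \<notin> A'"
    using A card.remove[OF A(1) a(1)] unfolding A'_def by blast+
  have F: "root_poly A = [:- a, 1:] * root_poly A'"
    unfolding A'_def using A a by (intro prod.remove)
  define g where "g = (\<Prod>b\<in>A'. l - const b * t)"
  have g: "g = homogenization l t (card A') (root_poly A')"
    by (simp add: g_def homogenization_root_poly A')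
  have "g \<notin> p"
  proof
    assume "g \<in> p"
    then obtain b where b: "b \<in> A'" "l - const b * t \<in> p"
      using prime_ideal_prod[OF P(2) A'(1)] unfolding g_def by blast
    have "(l - const b * t) - (l - const a * t) \<in> p"
      by (intro ideal.subspace_diff[OF P(3)] a b)
    then have "const (a - b) * t \<in> p"
      by (simp add: const_diff left_diff_distrib)
    then show False
      using const_mult_mem[OF P(3)] p(2) A' b by fastforce
  qed
  have c'_deg: "degree c' \<le> card A' + d"
  proof (cases "c' = 0")
    case False
    then have "degree c = Suc (degree c')"
      unfolding c' by (subst degree_mult_eq) auto
    moreover have "degree c \<le> card A'"
      using c(1) A' by (intro degree_le_if_coeff_eq_0) auto
    ultimately show ?thesis
      by simp
  qed simp
  \<comment> \<open>The missing linear factor of \<open>g\<close> is supplied by \<open>f\<close>, as \<open>f\<close> vanishes at the point.\<close>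
  have "g * homogenization l t (D + d) c = homogenization l t (card A' + (D + d)) (root_poly A' * c)"
    unfolding g using c_deg by (simp add: homogenization_mult)
  also have "root_poly A' * c = root_poly A * c'"
    unfolding F c' by (simp only: mult_ac)
  also have "card A' + (D + d) = D + (card A' + d)"
    by simp
  also have "homogenization l t (D + (card A' + d)) (root_poly A * c')
      = homogenization l t D (root_poly A) * homogenization l t (card A' + d) c'"
    using A c'_deg by (simp add: homogenization_mult)
  also have "\<dots> \<in> J"
    using ideal.subspace_scale[OF J A(3)] by (subst mult.commute)
  finally have "g * homogenization l t (D + d) c \<in> J" .
  then have "g * (t ^ D * f - homogenization l t (D + d) c) + g * homogenization l t (D + d) c \<in> J"
    using ideal.subspace_scale[OF J c(2)] by (intro ideal.subspace_add[OF J])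
  then have "(g * t ^ D) * f \<in> J"
    by (simp add: right_diff_distrib mult.assoc)
  moreover have "g * t ^ D \<notin> p"
    using \<open>g \<notin> p\<close> tD P(2) by (auto simp: prime_ideal_def)
  moreover have "g * t ^ D \<in> forms (card A' + 1 * D)"
    unfolding g by (intro forms_mult homogenization_in_forms forms_power l t)
  ultimately show thesis
    using that by blast
qed

text \<open>The ring modulo \<open>J\<close> is generated over \<open>\<real>[t]\<close> in degrees up to \<open>N\<close>.\<close>

lemma forms_mod_power:
  assumes J: "ideal.subspace J" and t: "t \<in> forms 1"
    and base: "\<And>f. f \<in> forms (Suc N) \<Longrightarrow> \<exists>g\<in>forms N. f - t * g \<in> J"
    and f: "f \<in> forms (k + N)"
  shows "\<exists>g\<in>forms N. f - t ^ k * g \<in> J"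
  using f
proof (induction k arbitrary: f)
  case 0
  then show ?case
    using ideal.subspace_0[OF J] by (intro bexI[of _ f]) auto
next
  case (Suc k)
  then have "f \<in> forms (Suc (k + N))"
    by simp
  then obtain g where g: "\<And>v. g v \<in> forms (k + N)" "f = (\<Sum>v\<in>UNIV. var v * g v)"
    using forms_Suc_cases by metis
  have "\<forall>v. \<exists>h\<in>forms N. g v - t ^ k * h \<in> J"
    using Suc.IH g(1) by blast
  then obtain h where h: "\<And>v. h v \<in> forms N" "\<And>v. g v - t ^ k * h v \<in> J"
    by metis
  have "var v * h v \<in> forms (Suc N)" for v
    using forms_mult[OF var_in_forms h(1)] by simp
  then have "(\<Sum>v\<in>UNIV. var v * h v) \<in> forms (Suc N)"
    by (intro forms_sum)
  then obtain u where u: "u \<in> forms N" "(\<Sum>v\<in>UNIV. var v * h v) - t * u \<in> J"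
    using base by blast
  have "f - t ^ Suc k * u = (\<Sum>v\<in>UNIV. var v * (g v - t ^ k * h v))
      + t ^ k * ((\<Sum>v\<in>UNIV. var v * h v) - t * u)"
    by (simp add: g(2) algebra_simps sum_subtractf sum_distrib_left)
  also have "\<dots> \<in> J"
    by (intro ideal.subspace_add[OF J] ideal.subspace_sum[OF J] ideal.subspace_scale[OF J h(2)]
        ideal.subspace_scale[OF J u(2)])
  finally show ?case
    using u(1) by blast
qed

text \<open>The hypothesis \<open>base\<close> says that the ring is finite over \<open>\<real>[t]\<close>, and \<open>unram\<close> that the points
  are reduced. Each coordinate takes finitely many values at the points, which are all real; so
  there are finitely many points, and some linear form \<open>l\<close> separates them. By Lagrange
  interpolation, a form agrees at all points with a polynomial in \<open>l\<close>. A form that vanishes at all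
  points is zero up to a power of \<open>t\<close>, as the points are reduced.\<close>

lemma splits_if_real_reduced:
  fixes J :: "('v::finite) rpoly set"
  assumes J: "homogeneous_ideal J" and t: "t \<in> forms 1"
    and base: "\<And>f. f \<in> forms (Suc N) \<Longrightarrow> \<exists>g\<in>forms N. f - t * g \<in> J"
    and off: "\<And>p. p \<in> proj_points J \<Longrightarrow> t \<notin> p"
    and real: "\<And>p. p \<in> proj_points J \<Longrightarrow> real_point p"
    and unram: "\<And>p d f. p \<in> proj_points J \<Longrightarrow> f \<in> p \<inter> forms d \<Longrightarrow> \<exists>s. s \<notin> p \<and> s * f \<in> J"
  obtains D a A where "splits J t D (linear_form a) A"
proof -
  let ?P = "proj_points J"
  note sub = homogeneous_idealD[OF J]
  have ev: "\<exists>c. f - const c * t ^ d \<in> p" if p: "p \<in> ?P" and f: "f \<in> forms d" for p f d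
  proof -
    have "t ^ d \<in> forms d - p"
      using forms_power[OF t, of d] prime_ideal_power[OF proj_pointsD(2)[OF p]] off[OF p] by auto
    then show ?thesis
      using real[OF p] f unfolding real_point_def by blast
  qed
  have "\<forall>p\<in>?P. \<exists>x :: real ^ 'v. \<forall>v. var v - const (x $ v) * t \<in> p"
  proof
    fix p assume p: "p \<in> ?P"
    have "\<forall>v. \<exists>c. var v - const c * t \<in> p"
      using ev[OF p var_in_forms] by simp
    then obtain c where "\<And>v. var v - const (c v) * t \<in> p"
      by metis
    then show "\<exists>x :: real ^ 'v. \<forall>v. var v - const (x $ v) * t \<in> p"
      by (intro exI[of _ "\<chi> v. c v"]) simp
  qed
  then obtain x :: "'v rpoly set \<Rightarrow> real ^ 'v"
    where x: "\<And>p v. p \<in> ?P \<Longrightarrow> var v - const (x p $ v) * t \<in> p"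
    by metis
  have inj: "inj_on x ?P"
  proof (rule inj_onI)
    fix p q assume "p \<in> ?P" "q \<in> ?P" "x p = x q"
    then show "p = q"
      using x[of p] x[of q] off by (intro point_unique[where c = "\<lambda>v. x p $ v"]) auto
  qed
  have unique: "c = c'" if p: "p \<in> ?P" and "g - const c * t \<in> p" "g - const c' * t \<in> p" for p g c c'
  proof -
    have "(g - const c * t) - (g - const c' * t) \<in> p"
      by (rule ideal.subspace_diff[OF proj_pointsD(3)[OF p]]) fact+
    then have "const (c' - c) * t \<in> p"
      by (simp add: const_diff left_diff_distrib)
    then show ?thesis
      using const_mult_mem[OF proj_pointsD(3)[OF p]] off[OF p] by fastforce
  qed
  have "finite ?P"
  proof -
    have "\<exists>B. finite B \<and> (\<forall>p\<in>?P. x p $ v \<in> B)" for v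
    proof -
      have "t \<notin> p \<and> (\<exists>c. var v - const c * t \<in> p)" if "p \<in> ?P" for p
        using x off that by blast
      then obtain B where "finite B" "\<And>p. p \<in> ?P \<Longrightarrow> \<exists>c\<in>B. var v - const c * t \<in> p"
        using finitely_many_values[OF J t] by metis
      then show ?thesis
        using unique x by metis
    qed
    then obtain B where B: "\<And>v. finite (B v)" "\<And>p v. p \<in> ?P \<Longrightarrow> x p $ v \<in> B v"
      by metis
    have "finite (vec_nth ` x ` ?P)"
      by (rule finite_subset[of _ "Pi\<^sub>E UNIV B"]) (auto simp: B finite_PiE)
    then have "finite (x ` ?P)"
      by (rule finite_imageD) (auto simp: inj_on_def vec_nth_inject)
    then show ?thesis
      using inj by (rule finite_imageD)
  qed
  obtain a where a: "inj_on (\<lambda>y. inner a y) (x ` ?P)"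
    using ex_separating_functional[of "x ` ?P"] \<open>finite ?P\<close> by blast
  define val where "val = (\<lambda>p. inner a (x p))"
  have inj_val: "inj_on val ?P"
    using comp_inj_on[OF inj a] by (simp add: val_def comp_def)
  define l where "l = linear_form a"
  have l_form: "l \<in> forms 1"
    by (simp add: l_def del: One_nat_def)
  have l: "l - const (val p) * t \<in> p" if "p \<in> ?P" for p
    unfolding l_def val_def using proj_pointsD(3)[OF that] x[OF that] by (rule linear_form_mod)
  define A where "A = val ` ?P"
  have A: "finite A"
    using \<open>finite ?P\<close> by (simp add: A_def)
  have kill: "\<exists>e. t ^ e * f \<in> J" if f: "f \<in> forms d" and "\<And>p. p \<in> ?P \<Longrightarrow> f \<in> p" for f d
    using power_mult_mem_if_locally_zero[OF J t f] unram that by (metis IntI)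
  have up: "t ^ e' * f \<in> J" if "t ^ e * f \<in> J" "e \<le> e'" for e e' f
    using ideal.subspace_scale[OF sub that(1), of "t ^ (e' - e)"] that(2)
    by (simp flip: power_add mult.assoc)
  have "\<exists>e. t ^ e * homogenization l t (card A) (root_poly A) \<in> J"
  proof (rule kill[OF homogenization_in_forms[OF l_form t]])
    fix p assume p: "p \<in> ?P"
    have "homogenization l t (card A) (root_poly A) - const (poly (root_poly A) (val p)) * t ^ card A \<in> p"
      by (rule homogenization_mod[OF proj_pointsD(3)[OF p] l[OF p]]) simp
    moreover have "poly (root_poly A) (val p) = 0"
      using A p by (auto simp: poly_prod A_def)
    ultimately show "homogenization l t (card A) (root_poly A) \<in> p"
      by simp
  qed
  then obtain e0 where e0: "t ^ e0 * homogenization l t (card A) (root_poly A) \<in> J" ..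
  let ?Q = "\<lambda>f e c. (\<forall>i\<ge>card A. coeff c i = 0) \<and>
      t ^ e * (t ^ card A * f - homogenization l t (card A + N) c) \<in> J"
  have low: "\<exists>e c. ?Q f e c" if f: "f \<in> forms N" for f
  proof -
    have "\<forall>p\<in>?P. \<exists>r. f - const r * t ^ N \<in> p"
      using ev f by blast
    then obtain r where r: "\<And>p. p \<in> ?P \<Longrightarrow> f - const (r p) * t ^ N \<in> p"
      by metis
    obtain c where c: "\<forall>i\<ge>card A. coeff c i = 0" "\<forall>y\<in>A. poly c y = r (inv_into ?P val y)"
      using ex_interpolation_poly[OF A, of "\<lambda>y. r (inv_into ?P val y)"] by blast
    have "degree c \<le> card A + N"
      using c(1) by (intro degree_le) auto
    have "\<exists>e. t ^ e * (t ^ card A * f - homogenization l t (card A + N) c) \<in> J"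
    proof (rule kill)
      show "t ^ card A * f - homogenization l t (card A + N) c \<in> forms (card A + N)"
        using forms_mult[OF forms_power[OF t] f, of "card A"]
        by (intro forms_diff homogenization_in_forms[OF l_form t]) simp
      fix p assume p: "p \<in> ?P"
      note P = proj_pointsD(3)[OF p]
      have "poly c (val p) = r p"
        using c(2) p inj_val by (auto simp: A_def)
      then have "homogenization l t (card A + N) c - const (r p) * t ^ (card A + N) \<in> p"
        using homogenization_mod[OF P l[OF p] \<open>degree c \<le> card A + N\<close>] by simp
      with ideal.subspace_scale[OF P r[OF p], of "t ^ card A"]
      have "t ^ card A * (f - const (r p) * t ^ N)
          - (homogenization l t (card A + N) c - const (r p) * t ^ (card A + N)) \<in> p"
        by (rule ideal.subspace_diff[OF P])
      moreover have "t ^ card A * (f - const (r p) * t ^ N) = t ^ card A * f - const (r p) * t ^ (card A + N)"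
        by (simp add: right_diff_distrib power_add mult.left_commute)
      ultimately show "t ^ card A * f - homogenization l t (card A + N) c \<in> p"
        by simp
    qed
    then show ?thesis
      using c(1) by blast
  qed
  \<comment> \<open>As there are finitely many monomials, one power of \<open>t\<close> works for all forms of degree \<open>N\<close>.\<close>
  have "\<forall>\<^sub>F e in sequentially. \<forall>m\<in>{m. mdeg m = N}. \<exists>c. ?Q (Poly_Mapping.single m 1) e c"
  proof (rule eventually_ball_finite[OF finite_monomials], rule ballI)
    fix m :: "'v \<Rightarrow>\<^sub>0 nat" assume "m \<in> {m. mdeg m = N}"
    then have "Poly_Mapping.single m 1 \<in> forms N"
      by (simp add: forms_iff lookup_single when_def)
    then obtain e c where "?Q (Poly_Mapping.single m 1) e c"
      using low by blast
    then have "\<forall>e'\<ge>e. ?Q (Poly_Mapping.single m 1) e' c"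
      using up by blast
    then show "\<forall>\<^sub>F e in sequentially. \<exists>c. ?Q (Poly_Mapping.single m 1) e c"
      unfolding eventually_sequentially by blast
  qed
  then obtain e1 where e1: "\<And>m e. mdeg m = N \<Longrightarrow> e \<ge> e1 \<Longrightarrow> \<exists>c. ?Q (Poly_Mapping.single m 1) e c"
    by (auto simp: eventually_sequentially)
  define e where "e = max e0 e1"
  have "\<forall>m. \<exists>c. mdeg m = N \<longrightarrow> ?Q (Poly_Mapping.single m 1) e c"
    using e1[of _ e] by (auto simp: e_def)
  then obtain c where c: "\<And>m. mdeg m = N \<Longrightarrow> ?Q (Poly_Mapping.single m 1) e (c m)"
    by metis
  have all: "\<exists>c. ?Q f e c" if f: "f \<in> forms N" for f
  proof
    let ?k = "Poly_Mapping.keys f"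
    let ?c = "\<Sum>m\<in>?k. smult (Poly_Mapping.lookup f m) (c m)"
    have m: "mdeg m = N" if "m \<in> ?k" for m
      using f that by (auto simp: forms_iff in_keys_iff)
    have fs: "f = (\<Sum>m\<in>?k. const (Poly_Mapping.lookup f m) * Poly_Mapping.single m 1)"
      using sum_single[of f] by (simp add: const_mult_single)
    have "t ^ e * (t ^ card A * f - homogenization l t (card A + N) ?c) =
      (\<Sum>m\<in>?k. const (Poly_Mapping.lookup f m) *
        (t ^ e * (t ^ card A * Poly_Mapping.single m 1 - homogenization l t (card A + N) (c m))))"
      by (subst fs) (simp add: homogenization_sum homogenization_smult sum_distrib_left right_diff_distrib
          sum_subtractf mult_ac)
    also have "\<dots> \<in> J"
    proof (rule ideal.subspace_sum[OF sub], rule ideal.subspace_scale[OF sub])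
      show "t ^ e * (t ^ card A * Poly_Mapping.single m 1 - homogenization l t (card A + N) (c m)) \<in> J"
        if "m \<in> ?k" for m
        using c m that by blast
    qed
    finally show "?Q f e ?c"
      using c m by (auto simp: coeff_sum)
  qed
  have "splits J t (e + card A + N) l A"
    unfolding splits_def
  proof (intro conjI ballI)
    show "finite A" "card A \<le> e + card A + N"
      using A by auto
    have "e + card A + N = (e + N) + card A"
      by simp
    then have "homogenization l t (e + card A + N) (root_poly A)
        = t ^ (e + N) * homogenization l t (card A) (root_poly A)"
      by (metis degree_root_poly homogenization_add_degree order_refl)
    then show "homogenization l t (e + card A + N) (root_poly A) \<in> J"
      using up[OF e0, of "e + N"] by (simp add: e_def)
    fix f :: "'v rpoly" assume "f \<in> forms (e + card A + N)"
    then obtain g where g: "g \<in> forms N" "f - t ^ (e + card A) * g \<in> J"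
      using forms_mod_power[OF sub t base] by blast
    obtain c where c: "?Q g e c"
      using all[OF g(1)] ..
    have "degree c \<le> card A + N"
      using c by (intro degree_le) auto
    then have "homogenization l t (e + card A + N) c = t ^ e * homogenization l t (card A + N) c"
      using homogenization_add_degree[of c "card A + N" l t e] by (simp add: add.assoc)
    then have "f - homogenization l t (e + card A + N) c = (f - t ^ (e + card A) * g)
        + t ^ e * (t ^ card A * g - homogenization l t (card A + N) c)"
      by (simp add: algebra_simps power_add)
    also have "\<dots> \<in> J"
      using g(2) c by (intro ideal.subspace_add[OF sub]) auto
    finally show "\<exists>c. (\<forall>i\<ge>card A. coeff c i = 0) \<and> f - homogenization l t (e + card A + N) c \<in> J"
      using c by blast
  qed
  then show thesis
    using that unfolding l_def by blast
qed

section \<open>The coefficient norm\<close>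

text \<open>With the sum of the absolute values of the coefficients as its norm, the polynomial ring is a
  normed algebra; so the rules for limits apply to products of polynomials. On the forms of a
  fixed degree, convergence in this norm is coefficientwise convergence.\<close>

instantiation poly_mapping :: (type, real_vector) real_vector
begin

lift_definition scaleR_poly_mapping :: "real \<Rightarrow> ('a \<Rightarrow>\<^sub>0 'b) \<Rightarrow> 'a \<Rightarrow>\<^sub>0 'b"
  is "\<lambda>r f x. r *\<^sub>R f x"
  by (rule finite_subset[rotated]) auto

instance
  by standard (auto intro!: poly_mapping_eqI
      simp: scaleR_poly_mapping.rep_eq lookup_add scaleR_add_left scaleR_add_right)

end

lemma lookup_scaleR: "Poly_Mapping.lookup (r *\<^sub>R f) m = r *\<^sub>R Poly_Mapping.lookup f m"
  by (simp add: scaleR_poly_mapping.rep_eq)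

instantiation poly_mapping :: (type, real_normed_vector) real_normed_vector
begin

definition norm_poly_mapping :: "('a \<Rightarrow>\<^sub>0 'b) \<Rightarrow> real" where
  "norm_poly_mapping f = (\<Sum>m\<in>Poly_Mapping.keys f. norm (Poly_Mapping.lookup f m))"

definition dist_poly_mapping :: "('a \<Rightarrow>\<^sub>0 'b) \<Rightarrow> ('a \<Rightarrow>\<^sub>0 'b) \<Rightarrow> real" where
  "dist_poly_mapping f g = norm (f - g)"

definition sgn_poly_mapping :: "('a \<Rightarrow>\<^sub>0 'b) \<Rightarrow> 'a \<Rightarrow>\<^sub>0 'b" where
  "sgn_poly_mapping f = f /\<^sub>R norm f"

definition uniformity_poly_mapping :: "(('a \<Rightarrow>\<^sub>0 'b) \<times> ('a \<Rightarrow>\<^sub>0 'b)) filter" where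
  "uniformity_poly_mapping = (INF e\<in>{0 <..}. principal {(f, g). dist f g < e})"

definition open_poly_mapping :: "('a \<Rightarrow>\<^sub>0 'b) set \<Rightarrow> bool" where
  "open_poly_mapping S \<longleftrightarrow> (\<forall>f\<in>S. \<forall>\<^sub>F (f', g) in uniformity. f' = f \<longrightarrow> g \<in> S)"

lemma norm_poly_mapping_superset:
  assumes "finite S" "Poly_Mapping.keys f \<subseteq> S"
  shows "norm f = (\<Sum>m\<in>S. norm (Poly_Mapping.lookup (f :: 'a \<Rightarrow>\<^sub>0 'b) m))"
  unfolding norm_poly_mapping_def
  using assms by (intro sum.mono_neutral_left) (auto simp: in_keys_iff)

instance
proof
  fix f g :: "'a \<Rightarrow>\<^sub>0 'b" and r :: real
  show "norm f = 0 \<longleftrightarrow> f = 0"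
    by (auto simp: norm_poly_mapping_def sum_nonneg_eq_0_iff in_keys_iff intro: poly_mapping_eqI)
  let ?S = "Poly_Mapping.keys f \<union> Poly_Mapping.keys g"
  have "norm (f + g) = (\<Sum>m\<in>?S. norm (Poly_Mapping.lookup f m + Poly_Mapping.lookup g m))"
    using keys_add[of f g] by (subst norm_poly_mapping_superset[of ?S]) (auto simp: lookup_add)
  also have "\<dots> \<le> (\<Sum>m\<in>?S. norm (Poly_Mapping.lookup f m) + norm (Poly_Mapping.lookup g m))"
    by (intro sum_mono norm_triangle_ineq)
  also have "\<dots> = norm f + norm g"
    by (simp add: sum.distrib norm_poly_mapping_superset[of ?S])
  finally show "norm (f + g) \<le> norm f + norm g" .
  have "norm (r *\<^sub>R f) = (\<Sum>m\<in>Poly_Mapping.keys f. norm (r *\<^sub>R Poly_Mapping.lookup f m))"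
    by (subst norm_poly_mapping_superset[of "Poly_Mapping.keys f"]) (auto simp: in_keys_iff lookup_scaleR)
  then show "norm (r *\<^sub>R f) = \<bar>r\<bar> * norm f"
    by (simp add: norm_poly_mapping_def sum_distrib_left)
qed (simp_all add: dist_poly_mapping_def sgn_poly_mapping_def uniformity_poly_mapping_def
    open_poly_mapping_def)

end

lemma norm_lookup_le: "norm (Poly_Mapping.lookup f m) \<le> norm f"
proof (cases "m \<in> Poly_Mapping.keys f")
  case True
  then show ?thesis
    unfolding norm_poly_mapping_def by (intro member_le_sum) auto
qed (simp add: in_keys_iff)

lemma norm_single [simp]: "norm (Poly_Mapping.single m c) = norm c"
  by (simp add: norm_poly_mapping_def)

instance poly_mapping :: (comm_monoid_add, real_normed_field) real_normed_algebra_1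
proof
  fix f g :: "'a \<Rightarrow>\<^sub>0 'b" and r :: real
  have scale: "r *\<^sub>R h = Poly_Mapping.single 0 (of_real r) * h" for h :: "'a \<Rightarrow>\<^sub>0 'b"
  proof (rule poly_mapping_eqI)
    fix m
    show "Poly_Mapping.lookup (r *\<^sub>R h) m = Poly_Mapping.lookup (Poly_Mapping.single 0 (of_real r) * h) m"
      by (simp add: lookup_scaleR scaleR_conv_of_real Poly_Mapping.map.rep_eq when_def
          flip: mult_map_scale_conv_mult)
  qed
  show "r *\<^sub>R f * g = r *\<^sub>R (f * g)" "f * r *\<^sub>R g = r *\<^sub>R (f * g)"
    by (simp_all add: scale mult_ac)
  show "norm (1 :: 'a \<Rightarrow>\<^sub>0 'b) = 1"
    by (simp flip: single_one)
  have "f * g = (\<Sum>m\<in>Poly_Mapping.keys f. Poly_Mapping.single m (Poly_Mapping.lookup f m)) *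
      (\<Sum>m\<in>Poly_Mapping.keys g. Poly_Mapping.single m (Poly_Mapping.lookup g m))"
    by (simp add: sum_single)
  also have "norm \<dots> \<le> (\<Sum>m\<in>Poly_Mapping.keys f. \<Sum>m'\<in>Poly_Mapping.keys g.
      norm (Poly_Mapping.single m (Poly_Mapping.lookup f m) * Poly_Mapping.single m' (Poly_Mapping.lookup g m')))"
    unfolding sum_product by (intro sum_norm_le order_refl)
  also have "\<dots> = norm f * norm g"
    by (simp add: mult_single norm_mult sum_product norm_poly_mapping_def[of f] norm_poly_mapping_def[of g])
  finally show "norm (f * g) \<le> norm f * norm g" .
qed

text \<open>The vector space structure and the notions derived from it agree with the generic ones.\<close>

lemma scaleR_rpoly: "r *\<^sub>R (f :: 'v rpoly) = const r * f"
  by (rule poly_mapping_eqI) (simp add: lookup_scaleR lookup_const_mult)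

lemma rpoly_span: "rpoly.span = (span :: 'v rpoly set \<Rightarrow> 'v rpoly set)"
  unfolding span_raw_def by (simp add: scaleR_rpoly[abs_def])

lemma rpoly_independent: "rpoly.independent B \<longleftrightarrow> independent (B :: 'v rpoly set)"
  unfolding dependent_raw_def by (simp add: scaleR_rpoly[abs_def])

lemma rpoly_subspace: "rpoly.subspace = (subspace :: 'v rpoly set \<Rightarrow> bool)"
  unfolding subspace_raw_def by (simp add: scaleR_rpoly[abs_def])

lemma subspace_forms: "subspace (forms d)"
  by (auto simp: subspace_def forms_add scaleR_rpoly const_mult_forms)

section \<open>Perturbation of bases and of simple roots\<close>

lemma form_eq_sum_monomials:
  assumes "f \<in> forms d"
  shows "f = (\<Sum>m\<in>{m. mdeg m = d}. Poly_Mapping.lookup f m *\<^sub>R Poly_Mapping.single m 1)"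
proof -
  have "f = (\<Sum>m\<in>Poly_Mapping.keys f. Poly_Mapping.lookup f m *\<^sub>R Poly_Mapping.single m 1)"
    by (subst sum_single[symmetric]) (simp add: scaleR_rpoly const_def mult_single)
  also have "\<dots> = (\<Sum>m\<in>{m. mdeg m = d}. Poly_Mapping.lookup f m *\<^sub>R Poly_Mapping.single m 1)"
    using assms by (intro sum.mono_neutral_left finite_monomials) (auto simp: forms_iff in_keys_iff)
  finally show ?thesis .
qed

lemma forms_eq_span: "forms d = span ((\<lambda>m. Poly_Mapping.single m 1) ` {m. mdeg m = d})"
proof
  show "forms d \<subseteq> span ((\<lambda>m. Poly_Mapping.single m 1) ` {m :: 'a \<Rightarrow>\<^sub>0 nat. mdeg m = d})"
  proof
    fix f :: "'a rpoly" assume f: "f \<in> forms d"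
    have "(\<Sum>m\<in>{m. mdeg m = d}. Poly_Mapping.lookup f m *\<^sub>R Poly_Mapping.single m 1)
        \<in> span ((\<lambda>m. Poly_Mapping.single m 1) ` {m. mdeg m = d})"
      by (intro span_sum span_scale span_base) auto
    then show "f \<in> span ((\<lambda>m. Poly_Mapping.single m 1) ` {m. mdeg m = d})"
      by (subst form_eq_sum_monomials[OF f])
  qed
  show "span ((\<lambda>m. Poly_Mapping.single m 1) ` {m :: 'a \<Rightarrow>\<^sub>0 nat. mdeg m = d}) \<subseteq> forms d"
    by (intro span_minimal subspace_forms) (auto simp: forms_iff lookup_single when_def)
qed

lemma finite_independent_forms:
  fixes B :: "('a::finite) rpoly set"
  assumes "independent B" "B \<subseteq> forms d"
  shows "finite B"
proof -
  have "finite ((\<lambda>m. Poly_Mapping.single m (1::real)) ` {m :: 'a \<Rightarrow>\<^sub>0 nat. mdeg m = d})"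
    by (intro finite_imageI finite_monomials)
  from independent_span_bound[OF this assms(1)] show ?thesis
    using assms(2) by (simp add: forms_eq_span)
qed

text \<open>The equivalence of norms on the finite-dimensional space of forms. The constant is computed
  from the coordinates of the monomials.\<close>

lemma coefficients_bounded:
  assumes B: "independent B" "span B = forms d"
  obtains C where "C \<ge> 0" "\<And>c. (\<Sum>x\<in>B. \<bar>c x\<bar>) \<le> C * norm (\<Sum>x\<in>B. c x *\<^sub>R x)"
proof -
  have fin: "finite B"
    using B finite_independent_forms span_superset by metis
  let ?M = "{m. mdeg m = d}"
  define C where "C = (\<Sum>x\<in>B. \<Sum>m\<in>?M. \<bar>representation B (Poly_Mapping.single m 1) x\<bar>)"
  have mon: "Poly_Mapping.single m 1 \<in> span B" if "m \<in> ?M" for m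
    using that B by (simp add: forms_iff lookup_single when_def)
  have "(\<Sum>x\<in>B. \<bar>c x\<bar>) \<le> C * norm (\<Sum>x\<in>B. c x *\<^sub>R x)" for c
  proof -
    define f where "f = (\<Sum>x\<in>B. c x *\<^sub>R x)"
    have "f \<in> forms d"
      unfolding f_def B(2)[symmetric] by (intro span_sum span_scale span_base)
    have rep_c: "c x = representation B f x" if x: "x \<in> B" for x
    proof -
      have "representation B f x = (\<Sum>y\<in>B. c y * representation B y x)"
        unfolding f_def using B(1)
        by (subst representation_sum) (auto simp: representation_scale span_base span_scale)
      also have "\<dots> = (\<Sum>y\<in>B. if y = x then c y else 0)"
        using B(1) by (intro sum.cong) (auto simp: representation_basis)
      finally show ?thesis
        using x fin by simp
    qed
    note f_eq = form_eq_sum_monomials[OF \<open>f \<in> forms d\<close>]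
    have "\<bar>c x\<bar> \<le> (\<Sum>m\<in>?M. \<bar>representation B (Poly_Mapping.single m 1) x\<bar>) * norm f" if x: "x \<in> B" for x
    proof -
      have "c x = (\<Sum>m\<in>?M. Poly_Mapping.lookup f m * representation B (Poly_Mapping.single m 1) x)"
        using B(1) mon
        by (subst rep_c[OF x], subst f_eq, subst representation_sum)
          (auto simp: representation_scale span_scale)
      also have "\<bar>\<dots>\<bar> \<le> (\<Sum>m\<in>?M. \<bar>Poly_Mapping.lookup f m\<bar> * \<bar>representation B (Poly_Mapping.single m 1) x\<bar>)"
        by (rule order_trans[OF sum_abs]) (simp add: abs_mult)
      also have "\<dots> \<le> (\<Sum>m\<in>?M. norm f * \<bar>representation B (Poly_Mapping.single m 1) x\<bar>)"
        using norm_lookup_le[of f] by (intro sum_mono mult_right_mono) auto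
      finally show ?thesis
        by (simp add: sum_distrib_left mult.commute)
    qed
    then have "(\<Sum>x\<in>B. \<bar>c x\<bar>) \<le> (\<Sum>x\<in>B. (\<Sum>m\<in>?M. \<bar>representation B (Poly_Mapping.single m 1) x\<bar>) * norm f)"
      by (rule sum_mono)
    then show ?thesis
      by (simp add: C_def f_def sum_distrib_right)
  qed
  moreover have "C \<ge> 0"
    by (simp add: C_def sum_nonneg)
  ultimately show thesis
    using that by blast
qed

text \<open>A family near a basis is still a basis. The bound on the coefficients is uniform, so the
  coefficients of a family of forms that tends to zero tend to zero as well.\<close>

lemma basis_perturbation:
  fixes Z :: "'p \<Rightarrow> ('v::finite) rpoly \<Rightarrow> 'v rpoly"
  assumes B: "independent B" "span B = forms d"
    and lim: "\<And>x. x \<in> B \<Longrightarrow> ((\<lambda>p. Z p x) \<longlongrightarrow> x) F"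
    and forms: "\<And>x. x \<in> B \<Longrightarrow> \<forall>\<^sub>F p in F. Z p x \<in> forms d"
  obtains C where "\<forall>\<^sub>F p in F. \<forall>f\<in>forms d. \<exists>c. f = (\<Sum>x\<in>B. c x *\<^sub>R Z p x) \<and> (\<forall>x\<in>B. \<bar>c x\<bar> \<le> C * norm f)"
proof -
  have fin: "finite B"
    using B finite_independent_forms span_superset by metis
  obtain C where C: "C \<ge> 0" "\<And>c. (\<Sum>x\<in>B. \<bar>c x\<bar>) \<le> C * norm (\<Sum>x\<in>B. c x *\<^sub>R x)"
    using coefficients_bounded[OF B] by blast
  \<comment> \<open>Moving the basis by \<open>e\<close> costs at most half of the sum of the coefficients.\<close>
  define e where "e = 1 / (2 * (C + 1))"
  have e: "e > 0" "C * e \<le> 1 / 2"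
  proof -
    show "e > 0"
      using C(1) by (simp add: e_def)
    then have "C * e \<le> (C + 1) * e"
      by (intro mult_right_mono) auto
    also have "\<dots> = 1 / 2"
      using C(1) by (simp add: e_def)
    finally show "C * e \<le> 1 / 2" .
  qed
  have "\<forall>\<^sub>F p in F. \<forall>x\<in>B. norm (Z p x - x) < e \<and> Z p x \<in> forms d"
  proof (rule eventually_ball_finite[OF fin], rule ballI, rule eventually_conj)
    fix x assume x: "x \<in> B"
    show "\<forall>\<^sub>F p in F. norm (Z p x - x) < e"
      using tendstoD[OF lim[OF x] e(1)] by (simp add: dist_norm)
    show "\<forall>\<^sub>F p in F. Z p x \<in> forms d"
      using x by (rule forms)
  qed
  then have "\<forall>\<^sub>F p in F. \<forall>f\<in>forms d. \<exists>c. f = (\<Sum>x\<in>B. c x *\<^sub>R Z p x) \<and> (\<forall>x\<in>B. \<bar>c x\<bar> \<le> 2 * C * norm f)"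
  proof eventually_elim
    case (elim p)
    have bound: "(\<Sum>x\<in>B. \<bar>c x\<bar>) \<le> 2 * C * norm (\<Sum>x\<in>B. c x *\<^sub>R Z p x)" for c
    proof -
      have split: "(\<Sum>x\<in>B. c x *\<^sub>R x) = (\<Sum>x\<in>B. c x *\<^sub>R Z p x) + (\<Sum>x\<in>B. c x *\<^sub>R (x - Z p x))"
        by (simp add: scaleR_diff_right sum_subtractf)
      have "norm (\<Sum>x\<in>B. c x *\<^sub>R (x - Z p x)) \<le> (\<Sum>x\<in>B. \<bar>c x\<bar> * e)"
        using elim by (intro sum_norm_le) (simp add: norm_minus_commute mult_left_mono less_imp_le)
      then have "norm (\<Sum>x\<in>B. c x *\<^sub>R x) \<le> norm (\<Sum>x\<in>B. c x *\<^sub>R Z p x) + (\<Sum>x\<in>B. \<bar>c x\<bar>) * e"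
        unfolding split sum_distrib_right by (intro norm_triangle_le) simp
      then have "(\<Sum>x\<in>B. \<bar>c x\<bar>) \<le> C * (norm (\<Sum>x\<in>B. c x *\<^sub>R Z p x) + (\<Sum>x\<in>B. \<bar>c x\<bar>) * e)"
        using C by (meson mult_left_mono order_trans)
      moreover have "(\<Sum>x\<in>B. \<bar>c x\<bar>) * (C * e) \<le> (\<Sum>x\<in>B. \<bar>c x\<bar>) * (1 / 2)"
        using e(2) by (intro mult_left_mono sum_nonneg) auto
      ultimately show ?thesis
        by (simp add: algebra_simps)
    qed
    have zero: "c x = 0" if "(\<Sum>x\<in>B. c x *\<^sub>R Z p x) = 0" "x \<in> B" for c x
    proof -
      have "(\<Sum>x\<in>B. \<bar>c x\<bar>) \<le> 0"
        using bound[of c] that by simp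
      moreover have "\<bar>c x\<bar> \<le> (\<Sum>x\<in>B. \<bar>c x\<bar>)"
        using that fin by (intro member_le_sum) auto
      ultimately show ?thesis
        by simp
    qed
    have inj: "inj_on (Z p) B"
    proof (rule inj_onI, rule ccontr)
      fix x y assume xy: "x \<in> B" "y \<in> B" "Z p x = Z p y" "x \<noteq> y"
      have "(\<Sum>z\<in>B. (if z = x then 1 else if z = y then - 1 else 0) *\<^sub>R Z p z) = (\<Sum>z\<in>{x, y}. (if z = x then 1 else - 1) *\<^sub>R Z p z)"
        using fin xy by (intro sum.mono_neutral_cong_right) auto
      also have "\<dots> = 0"
        using xy by simp
      finally show False
        using zero[of "\<lambda>z. if z = x then 1 else if z = y then - 1 else 0" x] xy by simp
    qed
    have ind: "independent (Z p ` B)"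
    proof (rule independent_if_scalars_zero)
      fix c y assume "(\<Sum>y\<in>Z p ` B. c y *\<^sub>R y) = 0" "y \<in> Z p ` B"
      then show "c y = 0"
        using zero[of "\<lambda>x. c (Z p x)"] by (auto simp: sum.reindex[OF inj])
    qed (use fin in simp)
    have sub: "Z p ` B \<subseteq> span B"
      using elim B by auto
    \<comment> \<open>An independent set of the size of a basis generates.\<close>
    have "x \<in> span (Z p ` B)" if x: "x \<in> B" for x
    proof (rule ccontr)
      assume nx: "x \<notin> span (Z p ` B)"
      then have "independent (insert x (Z p ` B))"
        using ind by (intro independent_insertI)
      then have "card (insert x (Z p ` B)) \<le> card B"
        using independent_span_bound[OF fin] sub x by (auto intro: span_base)
      moreover have "x \<notin> Z p ` B"
        using nx span_base[of x "Z p ` B"] by argo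
      ultimately show False
        using card_image[OF inj] fin by simp
    qed
    then have span: "forms d \<subseteq> span (Z p ` B)"
      unfolding B(2)[symmetric] by (intro span_minimal) auto
    show ?case
    proof
      fix f :: "'v rpoly" assume "f \<in> forms d"
      then obtain u where "f = (\<Sum>y\<in>Z p ` B. u y *\<^sub>R y)"
        using span fin by (auto simp: span_finite)
      then have f: "f = (\<Sum>x\<in>B. u (Z p x) *\<^sub>R Z p x)"
        by (simp add: sum.reindex[OF inj])
      have "\<bar>u (Z p x)\<bar> \<le> 2 * C * norm f" if "x \<in> B" for x
        using bound[of "\<lambda>x. u (Z p x)"] member_le_sum[OF that, of "\<lambda>x. \<bar>u (Z p x)\<bar>"] fin f by simp
      then show "\<exists>c. f = (\<Sum>x\<in>B. c x *\<^sub>R Z p x) \<and> (\<forall>x\<in>B. \<bar>c x\<bar> \<le> 2 * C * norm f)"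
        using f by (intro exI[of _ "\<lambda>x. u (Z p x)"]) blast
    qed
  qed
  then show thesis
    using that by blast
qed

text \<open>Around each simple root the polynomial changes its sign on a small interval. The sign change
  persists under a small perturbation, which therefore has a root in each of these disjoint
  intervals; these are all its roots, by its degree.\<close>

lemma root_poly_perturbation:
  assumes A: "finite A" and R: "\<forall>\<^sub>F p in F. \<forall>i\<ge>card A. coeff (R p) i = 0"
    and lim: "\<And>i. ((\<lambda>p. coeff (R p) i) \<longlongrightarrow> 0) F"
  shows "\<forall>\<^sub>F p in F. \<exists>A'. finite A' \<and> card A' = card A \<and> root_poly A - R p = root_poly A'"
proof -
  have "\<forall>\<^sub>F e in at_right 0. \<forall>a\<in>A. \<forall>b\<in>A. a \<noteq> b \<longrightarrow> 2 * e < \<bar>a - b\<bar>"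
  proof (intro eventually_ball_finite[OF A] ballI)
    fix a b :: real
    show "\<forall>\<^sub>F e in at_right 0. a \<noteq> b \<longrightarrow> 2 * e < \<bar>a - b\<bar>"
    proof (cases "a = b")
      case False
      then show ?thesis
        using eventually_at_right_real[of 0 "\<bar>a - b\<bar> / 2"] by (auto elim: eventually_mono)
    qed simp
  qed
  then have "\<forall>\<^sub>F e in at_right 0. (0::real) < e \<and> (\<forall>a\<in>A. \<forall>b\<in>A. a \<noteq> b \<longrightarrow> 2 * e < \<bar>a - b\<bar>)"
    using eventually_at_right_less[of "0::real"] by eventually_elim blast
  then obtain e where e: "e > 0" "\<And>a b. a \<in> A \<Longrightarrow> b \<in> A \<Longrightarrow> a \<noteq> b \<Longrightarrow> 2 * e < \<bar>a - b\<bar>"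
    using eventually_happens'[OF trivial_limit_at_right_real] by blast
  have lim_poly: "((\<lambda>p. poly (root_poly A - R p) x) \<longlongrightarrow> poly (root_poly A) x) F" for x
  proof -
    have "\<forall>\<^sub>F p in F. (\<Sum>i<card A. coeff (R p) i * x ^ i) = poly (R p) x"
      using R
    proof eventually_elim
      case (elim p)
      have "poly (R p) x = (\<Sum>i\<in>{..degree (R p)} \<inter> {..<card A}. coeff (R p) i * x ^ i)"
        unfolding poly_altdef using elim by (intro sum.mono_neutral_right) (auto simp: not_less)
      also have "\<dots> = (\<Sum>i<card A. coeff (R p) i * x ^ i)"
        by (intro sum.mono_neutral_left) (auto simp: coeff_eq_0)
      finally show ?case ..
    qed
    moreover have "((\<lambda>p. \<Sum>i<card A. coeff (R p) i * x ^ i) \<longlongrightarrow> (\<Sum>i<card A. 0 * x ^ i)) F"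
      by (intro tendsto_sum tendsto_mult_right lim)
    ultimately have "((\<lambda>p. poly (R p) x) \<longlongrightarrow> 0) F"
      by (simp add: tendsto_cong)
    then have "((\<lambda>p. poly (root_poly A) x - poly (R p) x) \<longlongrightarrow> poly (root_poly A) x - 0) F"
      by (intro tendsto_diff tendsto_const)
    then show ?thesis
      by simp
  qed
  have neg: "poly (root_poly A) (a - e) * poly (root_poly A) (a + e) < 0" if a: "a \<in> A" for a
  proof -
    have "poly (root_poly A) (a - e) * poly (root_poly A) (a + e) = (\<Prod>b\<in>A. (a - e - b) * (a + e - b))"
      by (simp add: poly_prod prod.distrib)
    also have "\<dots> = (- e * e) * (\<Prod>b\<in>A - {a}. (a - e - b) * (a + e - b))"
      using A a by (subst prod.remove) auto
    also have "\<dots> < 0"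
    proof (rule mult_neg_pos)
      show "0 < (\<Prod>b\<in>A - {a}. (a - e - b) * (a + e - b))"
      proof (rule prod_pos)
        fix b assume "b \<in> A - {a}"
        then have "2 * e < \<bar>a - b\<bar>"
          using e(2) a by auto
        then show "0 < (a - e - b) * (a + e - b)"
          using e(1) by (auto simp: zero_less_mult_iff abs_if split: if_splits)
      qed
    qed (use e(1) in simp)
    finally show ?thesis .
  qed
  have "\<forall>\<^sub>F p in F. \<forall>a\<in>A. poly (root_poly A - R p) (a - e) * poly (root_poly A - R p) (a + e) < 0"
    using order_tendstoD(2)[OF tendsto_mult[OF lim_poly lim_poly] neg]
    by (intro eventually_ball_finite[OF A]) blast
  with R show ?thesis
  proof eventually_elim
    case (elim p)
    have "\<forall>a\<in>A. \<exists>x. a - e < x \<and> x < a + e \<and> poly (root_poly A - R p) x = 0"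
      using elim e(1) poly_IVT[of _ _ "root_poly A - R p"] by (auto simp del: poly_diff)
    then obtain r where r: "\<And>a. a \<in> A \<Longrightarrow> a - e < r a \<and> r a < a + e \<and> poly (root_poly A - R p) (r a) = 0"
      by metis
    have inj: "inj_on r A"
    proof (rule inj_onI, rule ccontr)
      fix a b assume ab: "a \<in> A" "b \<in> A" "r a = r b" "a \<noteq> b"
      then show False
        using r[OF ab(1)] r[OF ab(2)] e(2)[OF ab(1,2,4)] by auto
    qed
    then have card: "card (r ` A) = card A"
      by (rule card_image)
    let ?d = "root_poly A - R p - root_poly (r ` A)"
    have "coeff ?d i = 0" if i: "i \<ge> card A" for i
    proof -
      have monic: "coeff (root_poly S) (card S) = 1" for S :: "real set"
        using lead_coeff_prod[of "\<lambda>a. [:- a, 1:]" S] by simp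
      show ?thesis
        using elim i monic[of A] monic[of "r ` A"] card
        by (cases "i = card A") (auto simp: coeff_eq_0)
    qed
    then have deg: "?d = 0 \<or> degree ?d < card A"
      by (metis leading_coeff_0_iff not_le)
    have "?d = 0"
    proof (rule ccontr)
      assume ne: "?d \<noteq> 0"
      have "r ` A \<subseteq> {x. poly ?d x = 0}"
        using r A by (auto simp: poly_prod)
      then have "card A \<le> card {x. poly ?d x = 0}"
        using card_mono[OF poly_roots_finite[OF ne]] card by metis
      also have "\<dots> \<le> degree ?d"
        using card_poly_roots_bound[OF ne] .
      finally show False
        using deg ne by simp
    qed
    then show ?case
      using A card by (intro exI[of _ "r ` A"]) auto
  qed
qed

section \<open>The fibres of the projection\<close>

lemma linear_form_scaleR: "linear_form (r *\<^sub>R a) = const r * linear_form a"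
  by (simp add: linear_form_def const_mult sum_distrib_left mult.assoc)

lemma linear_form_diff: "linear_form (a - b) = linear_form a - linear_form b"
  by (simp add: linear_form_def const_diff left_diff_distrib sum_subtractf)

lemma tendsto_linear_form:
  assumes "(U \<longlongrightarrow> u) F"
  shows "((\<lambda>p. linear_form (U p)) \<longlongrightarrow> linear_form u) F"
  unfolding linear_form_def scaleR_rpoly[symmetric]
  by (intro tendsto_sum tendsto_scaleR tendsto_const tendsto_vec_nth assms)

lemma linear_equations_span_insert:
  "linear_equations (span (insert u E)) = {linear_form w | w. w \<in> E\<^sup>\<bottom> \<and> inner w u = 0}"
proof -
  have "(\<forall>x\<in>span (insert u E). inner w x = 0) \<longleftrightarrow> w \<in> E\<^sup>\<bottom> \<and> inner w u = 0" for w
  proof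
    assume "\<forall>x\<in>span (insert u E). inner w x = 0"
    then show "w \<in> E\<^sup>\<bottom> \<and> inner w u = 0"
      by (auto simp: orthogonal_comp_def orthogonal_def inner_commute span_base)
  next
    assume w: "w \<in> E\<^sup>\<bottom> \<and> inner w u = 0"
    then have "orthogonal w y" if "y \<in> insert u E" for y
      using that by (auto simp: orthogonal_comp_def orthogonal_def inner_commute)
    then show "\<forall>x\<in>span (insert u E). inner w x = 0"
      using orthogonal_to_span[of _ "insert u E" w] by (simp add: orthogonal_def)
  qed
  then show ?thesis
    by (auto simp: linear_equations_def)
qed

lemma linear_equations_eq: "linear_equations E = {linear_form w | w. w \<in> E\<^sup>\<bottom>}"
  by (auto simp: linear_equations_def orthogonal_comp_def orthogonal_def inner_commute)

lemma linear_equations_subset_forms: "linear_equations E \<subseteq> forms 1"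
  by (auto simp: linear_equations_def simp del: One_nat_def)

lemma homogeneous_linear_section:
  assumes "homogeneous_ideal I"
  shows "homogeneous_ideal (linear_section U I)"
proof -
  let ?X = "(I \<inter> (\<Union>d. forms d)) \<union> linear_equations U"
  have "I \<subseteq> ideal.span ?X"
    using assms ideal.span_mono[of "I \<inter> (\<Union>d. forms d)" ?X] by (auto simp: homogeneous_ideal_def)
  then have "linear_section U I \<subseteq> ideal.span ?X"
    unfolding linear_section_def
    by (intro ideal.span_minimal) (auto intro: ideal.span_base)
  moreover have "ideal.span ?X \<subseteq> linear_section U I"
    unfolding linear_section_def by (intro ideal.span_mono) auto
  moreover have "?X \<subseteq> (\<Union>d. forms d)"
    using linear_equations_subset_forms[of U] by blast
  ultimately show ?thesis
    using homogeneous_ideal_span[of ?X] by (metis subset_antisym)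
qed

text \<open>The ideal of the fibre over the point of the target that is given by the direction \<open>u\<close>.\<close>

abbreviation fibre_ideal :: "(real ^ 'v) set \<Rightarrow> ('v::finite) rpoly set \<Rightarrow> real ^ 'v \<Rightarrow> 'v rpoly set" where
  "fibre_ideal E I u \<equiv> linear_section (span (insert u E)) I"

lemma subset_linear_section: "I \<subseteq> linear_section U I" "linear_equations U \<subseteq> linear_section U I"
  by (auto simp: linear_section_def intro: ideal.span_base)

lemma linear_section_subset:
  "ideal.subspace J \<Longrightarrow> I \<subseteq> J \<Longrightarrow> linear_equations U \<subseteq> J \<Longrightarrow> linear_section U I \<subseteq> J"
  unfolding linear_section_def by (intro ideal.span_minimal) auto

text \<open>The unit sphere in the orthogonal complement of \<open>E\<close>. Every subspace that contains \<open>E\<close> with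
  codimension one is spanned by \<open>E\<close> and such a vector, which is unique up to its sign.\<close>

definition directions :: "(real ^ 'v) set \<Rightarrow> (real ^ ('v::finite)) set" where
  "directions E = {u \<in> E\<^sup>\<bottom>. norm u = 1}"

lemma compact_directions: "compact (directions E)"
proof -
  have "directions E = sphere 0 1 \<inter> E\<^sup>\<bottom>"
    by (auto simp: directions_def)
  moreover have "closed (E\<^sup>\<bottom>)"
    by (intro closed_subspace subspace_orthogonal_comp)
  ultimately show ?thesis
    by (simp add: compact_Int_closed)
qed

lemma inner_direction: "u \<in> directions E \<Longrightarrow> inner u u = 1"
  by (simp add: directions_def dot_square_norm)

lemma orthogonal_comp_diff_scaleR:
  "w \<in> E\<^sup>\<bottom> \<Longrightarrow> u \<in> E\<^sup>\<bottom> \<Longrightarrow> w - r *\<^sub>R u \<in> E\<^sup>\<bottom>"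
  by (intro subspace_diff subspace_scale subspace_orthogonal_comp)

lemma linear_form_mod_direction:
  assumes w: "w \<in> E\<^sup>\<bottom>" and u: "u \<in> directions E"
  shows "linear_form w - const (inner w u) * linear_form u \<in> linear_equations (span (insert u E))"
proof -
  have "inner (w - inner w u *\<^sub>R u) u = 0"
    using inner_direction[OF u] by (simp add: inner_diff_left)
  moreover have "w - inner w u *\<^sub>R u \<in> E\<^sup>\<bottom>"
    using w u by (intro orthogonal_comp_diff_scaleR) (auto simp: directions_def)
  moreover have "linear_form w - const (inner w u) * linear_form u = linear_form (w - inner w u *\<^sub>R u)"
    by (simp add: linear_form_diff linear_form_scaleR)
  ultimately show ?thesis
    unfolding linear_equations_span_insert by blast
qed

text \<open>Together with the equations of the fibre, \<open>linear_form u\<close> generates the equations of \<open>E\<close>, so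
  a point of the fibre where it vanishes would lie on \<open>E\<close>.\<close>

lemma direction_not_in_point:
  assumes off: "proj_points (linear_section E I) = {}" and u: "u \<in> directions E"
    and p: "p \<in> proj_points (fibre_ideal E I u)"
  shows "linear_form u \<notin> p"
proof
  assume t: "linear_form u \<in> p"
  note P = proj_pointsD[OF p]
  have "linear_equations E \<subseteq> p"
  proof
    fix f assume "f \<in> linear_equations E"
    then obtain w where w: "f = linear_form w" "w \<in> E\<^sup>\<bottom>"
      by (auto simp: linear_equations_eq)
    have "linear_form w - const (inner w u) * linear_form u \<in> p"
      using linear_form_mod_direction[OF w(2) u] subset_linear_section(2) P(4) by blast
    from ideal.subspace_add[OF P(3) this ideal.subspace_scale[OF P(3) t, of "const (inner w u)"]]
    show "f \<in> p"
      using w by simp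
  qed
  moreover have "I \<subseteq> p"
    using P(4) subset_linear_section(1) by blast
  ultimately have "linear_section E I \<subseteq> p"
    using P(3) by (intro linear_section_subset)
  then have "p \<in> proj_points (linear_section E I)"
    using p by (auto simp: proj_points_def)
  then show False
    using off by blast
qed

text \<open>This makes the ring of the fibre finite over \<open>\<real>[linear_form u]\<close>: its ideal and
  \<open>linear_form u\<close> together generate the ideal of the empty intersection with \<open>E\<close>.\<close>

lemma forms_mod_fibre_ideal:
  assumes I: "homogeneous_ideal I" and N: "forms N \<subseteq> linear_section E I" and u: "u \<in> directions E"
    and f: "f \<in> forms (Suc N)"
  shows "\<exists>g\<in>forms N. f - linear_form u * g \<in> fibre_ideal E I u"
proof -
  let ?J = "fibre_ideal E I u" and ?t = "linear_form u"
  note J = homogeneous_idealD[OF homogeneous_linear_section[OF I, of "span (insert u E)"]]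
  let ?K = "{h. \<exists>g. h - ?t * g \<in> ?J}"
  have K: "ideal.subspace ?K"
    unfolding ideal.subspace_def
  proof (intro conjI ballI allI)
    show "0 \<in> ?K"
      using ideal.subspace_0[OF J] by (auto intro!: exI[of _ 0])
    fix x y assume "x \<in> ?K" "y \<in> ?K"
    then obtain g h where "x - ?t * g \<in> ?J" "y - ?t * h \<in> ?J"
      by blast
    from ideal.subspace_add[OF J this] show "x + y \<in> ?K"
      by (auto intro!: exI[of _ "g + h"] simp: algebra_simps)
  next
    fix c x assume "x \<in> ?K"
    then obtain g where "x - ?t * g \<in> ?J"
      by blast
    from ideal.subspace_scale[OF J this, of c] show "c * x \<in> ?K"
      by (auto intro!: exI[of _ "c * g"] simp: right_diff_distrib mult.left_commute)
  qed
  have "linear_section E I \<subseteq> ?K"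
  proof (rule linear_section_subset[OF K])
    show "I \<subseteq> ?K"
      using subset_linear_section(1)[of I "span (insert u E)"] by (auto intro!: exI[of _ 0])
    show "linear_equations E \<subseteq> ?K"
    proof
      fix f assume "f \<in> linear_equations E"
      then obtain w where w: "f = linear_form w" "w \<in> E\<^sup>\<bottom>"
        by (auto simp: linear_equations_eq)
      have "linear_form w - const (inner w u) * linear_form u \<in> ?J"
        using linear_form_mod_direction[OF w(2) u] subset_linear_section(2) by blast
      then show "f \<in> ?K"
        using w by (auto intro!: exI[of _ "const (inner w u)"] simp: mult.commute)
    qed
  qed
  moreover have "f \<in> linear_section E I"
  proof -
    obtain g where g: "\<And>v. g v \<in> forms N" "f = (\<Sum>v\<in>UNIV. var v * g v)"
      using forms_Suc_cases[OF f] by metis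
    have sub: "ideal.subspace (linear_section E I)"
      by (simp add: linear_section_def)
    have "g v \<in> linear_section E I" for v
      using g(1) N by blast
    then show ?thesis
      unfolding g(2) by (intro ideal.subspace_sum[OF sub] ideal.subspace_scale[OF sub])
  qed
  ultimately obtain g where g: "f - ?t * g \<in> ?J"
    by blast
  have "component (Suc N) (f - ?t * g) \<in> ?J"
    using homogeneous_ideal_component[OF homogeneous_linear_section[OF I] g] .
  moreover have "component (Suc N) (f - ?t * g) = f - ?t * component N g"
  proof -
    have "component (Suc N) (?t * - g) = ?t * component N (- g)"
      using component_mult_form[OF linear_form_in_forms, of "Suc N" "- g" u] by (simp add: mult.commute)
    moreover have "component N (- g) = - component N g"
      by (rule poly_mapping_eqI) (simp add: component.rep_eq)
    ultimately show ?thesis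
      using f component_add[of "Suc N" f "?t * - g"] by (simp add: component_form)
  qed
  ultimately show ?thesis
    by (intro bexI[of _ "component N g"]) auto
qed

text \<open>Modulo the ideal of the fibre, a form in the coordinate ring of the target is a multiple of
  a power of \<open>linear_form u\<close>. It vanishes at the point only if the factor is zero. So the
  unramifiedness condition concerns the local ring of the fibre.\<close>

lemma projection_ring_subset_fibre_ideal:
  assumes I: "homogeneous_ideal I" and u: "u \<in> directions E"
    and p: "p \<in> proj_points (fibre_ideal E I u)" and t: "linear_form u \<notin> p"
  shows "p \<inter> projection_ring E \<subseteq> fibre_ideal E I u"
proof
  let ?J = "fibre_ideal E I u" and ?t = "linear_form u"
  note J = homogeneous_idealD[OF homogeneous_linear_section[OF I, of "span (insert u E)"]]
  note P = proj_pointsD[OF p]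
  have comp: "\<exists>c. component d g - const c * ?t ^ d \<in> ?J" if "g \<in> projection_ring E" for g d
    using that
  proof (induction arbitrary: d)
    case (const c)
    show ?case
      using ideal.subspace_0[OF J]
      by (intro exI[of _ "if d = 0 then c else 0"]) (simp add: component_form[OF const_in_forms])
  next
    case (linear f)
    then obtain w where w: "f = linear_form w" "w \<in> E\<^sup>\<bottom>"
      by (auto simp: linear_equations_eq)
    have "f - const (inner w u) * ?t \<in> ?J"
      using linear_form_mod_direction[OF w(2) u] subset_linear_section(2) w by blast
    then show ?case
      using ideal.subspace_0[OF J]
      by (intro exI[of _ "if d = 1 then inner w u else 0"])
        (simp add: component_form[OF linear_form_in_forms] w(1))
  next
    case (add f g)
    obtain a b where "component d f - const a * ?t ^ d \<in> ?J" "component d g - const b * ?t ^ d \<in> ?J"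
      using add.IH by blast
    from ideal.subspace_add[OF J this] show ?case
      by (intro exI[of _ "a + b"]) (simp add: component_add const_add algebra_simps)
  next
    case (mult f g)
    obtain a b where a: "\<And>i. component i f - const (a i) * ?t ^ i \<in> ?J"
      and b: "\<And>i. component i g - const (b i) * ?t ^ i \<in> ?J"
      using mult.IH by metis
    have "component d (f * g) - const (\<Sum>i\<le>d. a (d - i) * b i) * ?t ^ d
      = (\<Sum>i\<le>d. component (d - i) f * component i g - const (a (d - i) * b i) * ?t ^ d)"
      by (simp add: component_mult const_sum sum_distrib_right sum_subtractf)
    also have "\<dots> \<in> ?J"
    proof (rule ideal.subspace_sum[OF J])
      fix i assume "i \<in> {..d}"
      then have td: "?t ^ d = ?t ^ (d - i) * ?t ^ i"
        by (simp flip: power_add)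
      have "component i g * (component (d - i) f - const (a (d - i)) * ?t ^ (d - i))
          + (const (a (d - i)) * ?t ^ (d - i)) * (component i g - const (b i) * ?t ^ i) \<in> ?J"
        by (rule ideal.subspace_add[OF J ideal.subspace_scale[OF J a] ideal.subspace_scale[OF J b]])
      then show "component (d - i) f * component i g - const (a (d - i) * b i) * ?t ^ d \<in> ?J"
        unfolding td const_mult by (simp add: algebra_simps)
    qed
    finally show ?case
      by blast
  qed
  fix g assume g: "g \<in> p \<inter> projection_ring E"
  have "component d g \<in> ?J" for d
  proof -
    obtain c where c: "component d g - const c * ?t ^ d \<in> ?J"
      using comp g by blast
    have "component d g \<in> p"
      using homogeneous_ideal_component[OF P(1)] g by blast
    moreover have "component d g - const c * ?t ^ d \<in> p"
      using c P(4) by blast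
    ultimately have "component d g - (component d g - const c * ?t ^ d) \<in> p"
      by (rule ideal.subspace_diff[OF P(3)])
    then have "const c * ?t ^ d \<in> p"
      by simp
    then have "c = 0"
      using const_mult_mem[OF P(3)] prime_ideal_power[OF P(2)] t by blast
    then show ?thesis
      using c by simp
  qed
  then show "g \<in> ?J"
    by (rule mem_if_components[OF J])
qed

text \<open>The linear forms that vanish at a real point are those orthogonal to a vector \<open>x\<close>. The
  direction is the normalized component of \<open>x\<close> orthogonal to \<open>E\<close>.\<close>

lemma real_point_direction:
  assumes p: "p \<in> proj_points I" and real: "real_point p"
    and off: "proj_points (linear_section E I) = {}"
  obtains u where "u \<in> directions E" "p \<in> proj_points (fibre_ideal E I u)"
proof -
  note P = proj_pointsD[OF p]
  obtain w where w: "var w \<notin> p"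
  proof (rule ccontr)
    assume "\<not> thesis"
    then have all: "var v \<in> p" for v
      using that by blast
    have "f \<in> p" if "f \<in> forms 1" for f
    proof -
      have "f \<in> forms (Suc 0)"
        using that by simp
      then obtain g where "f = (\<Sum>v\<in>UNIV. var v * g v)"
        by (rule forms_Suc_cases)
      moreover have "g v * var v \<in> p" for v
        using all by (rule ideal.subspace_scale[OF P(3)])
      ultimately show ?thesis
        by (auto intro!: ideal.subspace_sum[OF P(3)] simp: mult.commute)
    qed
    then show False
      using P(5) by blast
  qed
  have "\<forall>v. \<exists>c. var v - const c * var w \<in> p"
    using real w var_in_forms unfolding real_point_def by blast
  then obtain c where c: "\<And>v. var v - const (c v) * var w \<in> p"
    by metis
  define x where "x = (\<chi> v. c v)"
  have lin: "linear_form a \<in> p \<longleftrightarrow> inner a x = 0" for a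
  proof -
    have m: "linear_form a - const (inner a x) * var w \<in> p"
      using P(3) by (rule linear_form_mod) (use c in \<open>simp add: x_def\<close>)
    show ?thesis
    proof
      assume "linear_form a \<in> p"
      from ideal.subspace_diff[OF P(3) this m] have "const (inner a x) * var w \<in> p"
        by simp
      then show "inner a x = 0"
        using const_mult_mem[OF P(3)] w by blast
    qed (use m in simp)
  qed
  have sub: "subspace (E\<^sup>\<bottom>)"
    by (rule subspace_orthogonal_comp)
  obtain y z where y: "y \<in> span (E\<^sup>\<bottom>)" and z: "\<And>w. w \<in> span (E\<^sup>\<bottom>) \<Longrightarrow> orthogonal z w"
    and x: "x = y + z"
    using orthogonal_subspace_decomp_exists[of "E\<^sup>\<bottom>" x] by metis
  have y: "y \<in> E\<^sup>\<bottom>"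
    using y sub by (metis span_eq_iff)
  have inner: "inner a x = inner a y" if "a \<in> E\<^sup>\<bottom>" for a
    using z[of a] that span_base[of a] by (simp add: x inner_right_distrib orthogonal_def inner_commute)
  have "y \<noteq> 0"
  proof
    assume "y = 0"
    then have "linear_equations E \<subseteq> p"
      using lin inner by (auto simp: linear_equations_eq)
    then have "linear_section E I \<subseteq> p"
      using P by (intro linear_section_subset)
    then show False
      using p off by (auto simp: proj_points_def)
  qed
  define u where "u = y /\<^sub>R norm y"
  have u: "u \<in> directions E"
    using y \<open>y \<noteq> 0\<close> sub by (auto simp: u_def directions_def subspace_scale)
  have "linear_equations (span (insert u E)) \<subseteq> p"
    using lin inner \<open>y \<noteq> 0\<close> by (auto simp: linear_equations_span_insert u_def)
  then have "fibre_ideal E I u \<subseteq> p"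
    using P by (intro linear_section_subset)
  then have "p \<in> proj_points (fibre_ideal E I u)"
    using p by (auto simp: proj_points_def)
  with u show thesis
    using that by blast
qed

section \<open>Splitting is stable under perturbation\<close>

text \<open>The degree \<open>D\<close> part of the ideal of the fibre, computed from the degree \<open>D\<close> part \<open>V\<close> of the
  ideal of the scheme. The generators depend continuously on a basis of \<open>V\<close> and, after replacing
  \<open>w\<close> by its projection orthogonal to \<open>u\<close>, on \<open>u\<close>. The degree \<open>D\<close> has to be positive, as the
  equations \<open>linear_form w\<close> of the fibre have degree one.\<close>

definition fibre_part ::
    "nat \<Rightarrow> ('v::finite) rpoly set \<Rightarrow> (real ^ 'v) set \<Rightarrow> real ^ 'v \<Rightarrow> 'v rpoly set" where
  "fibre_part D V E u =
    span (V \<union> {linear_form w * g | w g. w \<in> E\<^sup>\<bottom> \<and> inner w u = 0 \<and> g \<in> forms (D - 1)})"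

lemma subspace_ideal: "ideal.subspace I \<Longrightarrow> subspace (I :: 'v rpoly set)"
  using ideal.subspace_0[of I] ideal.subspace_add[of I] ideal.subspace_scale[of I]
  by (simp add: subspace_def scaleR_rpoly)

lemma fibre_part_eq:
  assumes I: "homogeneous_ideal I" and D: "D \<ge> 1"
  shows "fibre_part D (I \<inter> forms D) E u = fibre_ideal E I u \<inter> forms D"
proof
  let ?J = "fibre_ideal E I u" and ?W = "fibre_part D (I \<inter> forms D) E u"
  let ?G = "{linear_form w * g | w g. w \<in> E\<^sup>\<bottom> \<and> inner w u = 0 \<and> g \<in> forms (D - 1)}"
  note J = homogeneous_idealD[OF homogeneous_linear_section[OF I, of "span (insert u E)"]]
  have "subspace (?J \<inter> forms D)"
    by (intro subspace_inter subspace_forms subspace_ideal J)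
  moreover have "?G \<subseteq> ?J \<inter> forms D"
  proof
    fix f assume "f \<in> ?G"
    then obtain w g where f: "f = g * linear_form w" "w \<in> E\<^sup>\<bottom>" "inner w u = 0" "g \<in> forms (D - 1)"
      by (auto simp: mult.commute)
    then have "linear_form w \<in> ?J"
      using subset_linear_section(2)[of "span (insert u E)" I] by (auto simp: linear_equations_span_insert)
    then have "f \<in> ?J"
      unfolding f(1) by (rule ideal.subspace_scale[OF J])
    moreover have "f \<in> forms (D - 1 + 1)"
      unfolding f(1) by (intro forms_mult f(4) linear_form_in_forms)
    ultimately show "f \<in> ?J \<inter> forms D"
      using D by simp
  qed
  moreover have "I \<inter> forms D \<subseteq> ?J \<inter> forms D"
    using subset_linear_section(1)[of I "span (insert u E)"] by blast
  ultimately show "?W \<subseteq> ?J \<inter> forms D"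
    unfolding fibre_part_def by (intro span_minimal) auto
  have "component D h \<in> ?W" if "h \<in> ?J" for h
    using that unfolding linear_section_def
  proof (induction rule: ideal.span_induct_alt)
    case base
    show ?case
      by (simp add: fibre_part_def span_zero)
  next
    case (step c x y)
    have "component D (c * x) \<in> ?W"
    proof (cases "x \<in> I")
      case True
      then have "c * x \<in> I"
        using homogeneous_idealD[OF I] ideal.subspace_scale by blast
      then have "component D (c * x) \<in> I \<inter> forms D"
        using homogeneous_ideal_component[OF I] component_in_forms by blast
      then show ?thesis
        unfolding fibre_part_def by (intro span_base) blast
    next
      case False
      then obtain w where w: "x = linear_form w" "w \<in> E\<^sup>\<bottom>" "inner w u = 0"
        using step by (auto simp: linear_equations_span_insert)
      have "component D (c * x) = linear_form w * component (D - 1) c"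
        using component_mult_form[OF linear_form_in_forms, of D c w] D w by (simp add: mult.commute)
      then have "component D (c * x) \<in> ?G"
        using w component_in_forms by blast
      then show ?thesis
        unfolding fibre_part_def by (intro span_base) blast
    qed
    then show ?case
      using step unfolding component_add fibre_part_def by (intro span_add)
  qed
  then show "?J \<inter> forms D \<subseteq> ?W"
    by (metis IntE component_form subsetI)
qed

lemma splits_cong:
  assumes "J \<inter> forms D = J' \<inter> forms D" and l: "l \<in> forms 1" and t: "t \<in> forms 1"
  shows "splits J t D l A \<longleftrightarrow> splits J' t D l A"
proof -
  have *: "f \<in> J \<longleftrightarrow> f \<in> J'" if "f \<in> forms D" for f
    using assms(1) that by blast
  have h: "homogenization l t D c \<in> forms D" for c
    by (rule homogenization_in_forms[OF l t])
  show ?thesis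
    unfolding splits_def using *[OF h] *[OF forms_diff[OF _ h]] by auto
qed

lemma splits_fibre_part:
  assumes "homogeneous_ideal I" "D \<ge> 1"
  shows "splits (fibre_part D (I \<inter> forms D) E u) (linear_form u) D (linear_form a) A
    \<longleftrightarrow> splits (fibre_ideal E I u) (linear_form u) D (linear_form a) A"
  using fibre_part_eq[OF assms] by (intro splits_cong linear_form_in_forms) auto

lemma span_Un_span: "span (span X \<union> Y) = span (X \<union> Y)"
proof
  show "span (span X \<union> Y) \<subseteq> span (X \<union> Y)"
    using span_mono[of X "X \<union> Y"] by (intro span_minimal) (auto intro: span_base)
  show "span (X \<union> Y) \<subseteq> span (span X \<union> Y)"
    by (intro span_mono) (auto intro: span_base)
qed

text \<open>Choose a basis of the forms of degree \<open>D\<close> among the generators of the ideal of the fibre and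
  the products \<open>l ^ i * t ^ (D - i)\<close> with \<open>i < card A\<close>, and move it with \<open>p\<close>. It remains a basis,
  so all forms remain polynomials in \<open>l\<close> of small degree modulo the ideal. The form given by the
  roots \<open>A\<close> moves out of the ideal by a small amount only, which is compensated by a small change
  of the lower coefficients of its polynomial.\<close>

lemma splits_perturbation:
  fixes b0 :: "nat \<Rightarrow> ('v::finite) rpoly" and b :: "'p \<Rightarrow> nat \<Rightarrow> 'v rpoly" and E :: "(real ^ 'v) set"
  assumes D: "D \<ge> 1"
    and b: "\<And>j. j < r \<Longrightarrow> ((\<lambda>p. b p j) \<longlongrightarrow> b0 j) F"
    and b_forms: "\<And>j. j < r \<Longrightarrow> b0 j \<in> forms D" "\<And>j. j < r \<Longrightarrow> \<forall>\<^sub>F p in F. b p j \<in> forms D"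
    and U: "(U \<longlongrightarrow> u) F" "\<forall>\<^sub>F p in F. U p \<in> directions E" and u: "u \<in> directions E"
    and s: "splits (fibre_part D (span (b0 ` {..<r})) E u) (linear_form u) D (linear_form a) A"
  shows "\<forall>\<^sub>F p in F. \<exists>A'. splits (fibre_part D (span (b p ` {..<r})) E (U p)) (linear_form (U p)) D (linear_form a) A'"
proof -
  define l where "l = linear_form a"
  define W where "W = (\<lambda>p. fibre_part D (span (b p ` {..<r})) E (U p))"
  define H where "H = (\<lambda>p. homogenization l (linear_form (U p)) D)"
  define G where "G = b0 ` {..<r} \<union> {linear_form w * g | w g. w \<in> E\<^sup>\<bottom> \<and> inner w u = 0 \<and> g \<in> forms (D - 1)}"
  define S where "S = (\<lambda>i. l ^ i * linear_form u ^ (D - i)) ` {..<card A}"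
  define deforms where "deforms = (\<lambda>(z :: 'p \<Rightarrow> 'v rpoly) x. (z \<longlongrightarrow> x) F \<and> (\<forall>\<^sub>F p in F. z p \<in> forms D))"
  have l: "l \<in> forms 1"
    unfolding l_def by (rule linear_form_in_forms)
  have W: "subspace (W p)" for p
    by (simp add: W_def fibre_part_def)
  have A: "finite A" "card A \<le> D"
    using s by (auto simp: splits_def)
  have H_forms: "H p c \<in> forms D" for p c
    unfolding H_def by (intro homogenization_in_forms l linear_form_in_forms)
  have H_monom: "H p (monom 1 i) = l ^ i * linear_form (U p) ^ (D - i)" if "i \<le> D" for p i
  proof -
    have "H p (monom 1 i) = (\<Sum>j\<le>D. if j = i then l ^ i * linear_form (U p) ^ (D - i) else 0)"
      unfolding H_def homogenization_def by (intro sum.cong) auto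
    then show ?thesis
      using that by simp
  qed
  have H_lim: "((\<lambda>p. H p c) \<longlongrightarrow> homogenization l (linear_form u) D c) F" for c
    unfolding H_def homogenization_def
    by (intro tendsto_sum tendsto_mult tendsto_const tendsto_power tendsto_linear_form U)
  have W_G: "span G = fibre_part D (span (b0 ` {..<r})) E u"
    unfolding fibre_part_def G_def by (simp add: span_Un_span)
  \<comment> \<open>Each generator \<open>x\<close> extends to a continuous family, which consists of elements of \<open>W p\<close> up to a
    polynomial in \<open>l\<close>.\<close>
  have G_family: "\<exists>z. deforms z x \<and> (\<forall>\<^sub>F p in F. z p \<in> W p)" if x: "x \<in> G" for x
    using x unfolding G_def
  proof
    assume "x \<in> b0 ` {..<r}"
    then obtain j where j: "j < r" "x = b0 j"
      by auto
    have "b p j \<in> W p" for p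
      using j(1) unfolding W_def fibre_part_def by (intro span_base UnI1) auto
    then show ?thesis
      using b[OF j(1)] b_forms(2)[OF j(1)] j(2) by (intro exI[of _ "\<lambda>p. b p j"]) (auto simp: deforms_def)
  next
    assume "x \<in> {linear_form w * g | w g. w \<in> E\<^sup>\<bottom> \<and> inner w u = 0 \<and> g \<in> forms (D - 1)}"
    then obtain w g where x: "x = linear_form w * g" "w \<in> E\<^sup>\<bottom>" "inner w u = 0" "g \<in> forms (D - 1)"
      by blast
    let ?w = "\<lambda>p. w - inner w (U p) *\<^sub>R U p"
    have "((\<lambda>p. linear_form (?w p) * g) \<longlongrightarrow> linear_form (w - inner w u *\<^sub>R u) * g) F"
      by (intro tendsto_mult tendsto_linear_form tendsto_diff tendsto_const tendsto_scaleR tendsto_inner U)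
    then have "((\<lambda>p. linear_form (?w p) * g) \<longlongrightarrow> x) F"
      using x by simp
    moreover have "linear_form (?w p) * g \<in> forms D" for p
      using forms_mult[OF linear_form_in_forms x(4)] D by simp
    moreover have "\<forall>\<^sub>F p in F. linear_form (?w p) * g \<in> W p"
      using U(2)
    proof eventually_elim
      case (elim p)
      then have "?w p \<in> E\<^sup>\<bottom>" "inner (?w p) (U p) = 0"
        using x inner_direction[OF elim] orthogonal_comp_diff_scaleR
        by (auto simp: directions_def inner_diff_left)
      then show ?case
        using x(4) unfolding W_def fibre_part_def by (intro span_base UnI2) blast
    qed
    ultimately show ?thesis
      by (intro exI[of _ "\<lambda>p. linear_form (?w p) * g"]) (simp add: deforms_def)
  qed
  define splits_off where "splits_off = (\<lambda>(z :: 'p \<Rightarrow> 'v rpoly) q. (\<forall>i\<ge>card A. coeff q i = 0) \<and>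
      (\<forall>\<^sub>F p in F. z p - H p q \<in> W p))"
  have family: "\<exists>z q. deforms z x \<and> splits_off z q" if x: "x \<in> G \<union> S" for x
  proof (cases "x \<in> G")
    case True
    then obtain z where "deforms z x" "\<forall>\<^sub>F p in F. z p \<in> W p"
      using G_family by blast
    then show ?thesis
      by (intro exI[of _ z] exI[of _ 0]) (simp add: H_def splits_off_def)
  next
    case False
    then obtain i where i: "i < card A" "x = l ^ i * linear_form u ^ (D - i)"
      using x by (auto simp: S_def)
    have "((\<lambda>p. H p (monom 1 i)) \<longlongrightarrow> x) F"
      unfolding H_monom[OF order_trans[OF less_imp_le[OF i(1)] A(2)]] i(2)
      by (intro tendsto_mult tendsto_const tendsto_power tendsto_linear_form U)
    moreover have "H p (monom 1 i) - H p (monom 1 i) \<in> W p" for p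
      using W by (simp add: subspace_0)
    ultimately show ?thesis
      using i(1) H_forms by (intro exI[of _ "\<lambda>p. H p (monom 1 i)"] exI[of _ "monom 1 i"])
        (auto simp: deforms_def splits_off_def)
  qed
  then obtain z q where zq: "\<And>x. x \<in> G \<union> S \<Longrightarrow> deforms (z x) x \<and> splits_off (z x) (q x)"
    by metis
  have z_lim: "(z x \<longlongrightarrow> x) F" and z_forms: "\<forall>\<^sub>F p in F. z x p \<in> forms D"
    and q: "i \<ge> card A \<Longrightarrow> coeff (q x) i = 0" and z_W: "\<forall>\<^sub>F p in F. z x p - H p (q x) \<in> W p"
    if "x \<in> G \<union> S" for x i
    using zq[OF that] by (auto simp: deforms_def splits_off_def)
  have G_forms: "G \<subseteq> forms D"
    using b_forms(1) forms_mult[OF linear_form_in_forms, of _ "D - 1"] D by (auto simp: G_def)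
  have S_forms: "S \<subseteq> forms D"
  proof
    fix x assume "x \<in> S"
    then obtain i where i: "i < card A" "x = l ^ i * linear_form u ^ (D - i)"
      by (auto simp: S_def)
    have "x \<in> forms (1 * i + 1 * (D - i))"
      unfolding i(2) by (intro forms_mult forms_power l linear_form_in_forms)
    then show "x \<in> forms D"
      using i A by simp
  qed
  have "forms D \<subseteq> span (G \<union> S)"
  proof
    fix f :: "'v rpoly" assume "f \<in> forms D"
    then obtain c where c: "\<forall>i\<ge>card A. coeff c i = 0"
      "f - homogenization l (linear_form u) D c \<in> span G"
      using s unfolding splits_def W_G l_def by blast
    have "const (coeff c i) * l ^ i * linear_form u ^ (D - i) \<in> span (G \<union> S)" if "i \<le> D" for i
    proof (cases "i < card A")
      case True
      then have "coeff c i *\<^sub>R (l ^ i * linear_form u ^ (D - i)) \<in> span (G \<union> S)"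
        by (intro span_scale span_base) (auto simp: S_def)
      then show ?thesis
        by (simp add: scaleR_rpoly mult.assoc)
    next
      case False
      then show ?thesis
        using c(1) by (simp add: span_zero)
    qed
    then have "homogenization l (linear_form u) D c \<in> span (G \<union> S)"
      unfolding homogenization_def by (intro span_sum) auto
    moreover have "f - homogenization l (linear_form u) D c \<in> span (G \<union> S)"
      using c(2) span_mono[of G "G \<union> S"] by blast
    ultimately show "f \<in> span (G \<union> S)"
      using span_add by fastforce
  qed
  then have span_GS: "span (G \<union> S) = forms D"
    using G_forms S_forms by (intro antisym span_minimal subspace_forms) auto
  obtain B where B: "B \<subseteq> G \<union> S" "independent B" "G \<union> S \<subseteq> span B"
    by (rule maximal_independent_subset)
  have span_B: "span B = forms D"
    using B span_GS by (metis span_mono span_minimal subspace_span subset_antisym)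
  have fin: "finite B"
    using finite_independent_forms[OF B(2)] span_B span_superset[of B] by blast
  obtain C where C: "\<forall>\<^sub>F p in F. \<forall>f\<in>forms D. \<exists>c. f = (\<Sum>x\<in>B. c x *\<^sub>R z x p) \<and> (\<forall>x\<in>B. \<bar>c x\<bar> \<le> C * norm f)"
    using basis_perturbation[OF B(2) span_B, of "\<lambda>p x. z x p" F] z_lim z_forms B(1) by blast
  have combination: "(\<Sum>x\<in>B. c x *\<^sub>R z x p) - H p (\<Sum>x\<in>B. smult (c x) (q x)) \<in> W p"
    if "\<forall>x\<in>B. z x p - H p (q x) \<in> W p" for c p
  proof -
    have "(\<Sum>x\<in>B. c x *\<^sub>R z x p) - H p (\<Sum>x\<in>B. smult (c x) (q x)) = (\<Sum>x\<in>B. c x *\<^sub>R (z x p - H p (q x)))"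
      by (simp add: H_def homogenization_sum homogenization_smult scaleR_rpoly right_diff_distrib sum_subtractf)
    also have "\<dots> \<in> W p"
      using that by (intro subspace_sum[OF W] subspace_scale[OF W]) blast
    finally show ?thesis .
  qed
  have z_W_B: "\<forall>\<^sub>F p in F. \<forall>x\<in>B. z x p - H p (q x) \<in> W p"
    using z_W B(1) by (intro eventually_ball_finite[OF fin]) blast
  \<comment> \<open>The form given by the roots is a combination of elements of \<open>G\<close>. Its difference \<open>Y p\<close> from the
    moved combination tends to zero, and so do the coefficients of \<open>Y p\<close> in the moved basis.\<close>
  have "homogenization l (linear_form u) D (root_poly A) \<in> span G"
    using s unfolding splits_def W_G l_def by blast
  then obtain T \<beta> where T: "finite T" "T \<subseteq> G"
    and rel: "homogenization l (linear_form u) D (root_poly A) = (\<Sum>x\<in>T. \<beta> x *\<^sub>R x)"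
    unfolding span_explicit by blast
  have "\<forall>x\<in>G. \<exists>z. deforms z x \<and> (\<forall>\<^sub>F p in F. z p \<in> W p)"
    using G_family by blast
  then obtain y where y: "\<And>x. x \<in> G \<Longrightarrow> deforms (y x) x \<and> (\<forall>\<^sub>F p in F. y x p \<in> W p)"
    by metis
  have y_lim: "(y x \<longlongrightarrow> x) F" and y_forms: "\<forall>\<^sub>F p in F. y x p \<in> forms D"
    and y_W: "\<forall>\<^sub>F p in F. y x p \<in> W p" if "x \<in> G" for x
    using y[OF that] by (auto simp: deforms_def)
  define Y where "Y = (\<lambda>p. H p (root_poly A) - (\<Sum>x\<in>T. \<beta> x *\<^sub>R y x p))"
  have Y_lim: "(Y \<longlongrightarrow> 0) F"
  proof -
    have "(Y \<longlongrightarrow> homogenization l (linear_form u) D (root_poly A) - (\<Sum>x\<in>T. \<beta> x *\<^sub>R x)) F"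
      unfolding Y_def using T by (intro tendsto_diff H_lim tendsto_sum tendsto_scaleR tendsto_const y_lim) auto
    then show ?thesis
      using rel by simp
  qed
  have y_T: "\<forall>\<^sub>F p in F. \<forall>x\<in>T. y x p \<in> W p \<and> y x p \<in> forms D"
    using y_W y_forms T(2) by (intro eventually_ball_finite[OF T(1)] ballI eventually_conj) blast+
  define cc where "cc = (\<lambda>p. SOME c. Y p = (\<Sum>x\<in>B. c x *\<^sub>R z x p) \<and> (\<forall>x\<in>B. \<bar>c x\<bar> \<le> C * norm (Y p)))"
  have cc: "\<forall>\<^sub>F p in F. Y p = (\<Sum>x\<in>B. cc p x *\<^sub>R z x p) \<and> (\<forall>x\<in>B. \<bar>cc p x\<bar> \<le> C * norm (Y p))"
    using C y_T
  proof eventually_elim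
    case (elim p)
    have "Y p \<in> forms D"
      unfolding Y_def using elim(2)
      by (intro forms_diff H_forms subspace_sum[OF subspace_forms] subspace_scale[OF subspace_forms]) blast
    then have "\<exists>c. Y p = (\<Sum>x\<in>B. c x *\<^sub>R z x p) \<and> (\<forall>x\<in>B. \<bar>c x\<bar> \<le> C * norm (Y p))"
      using elim(1) by blast
    then show ?case
      unfolding cc_def by (rule someI_ex)
  qed
  have cc_lim: "((\<lambda>p. cc p x) \<longlongrightarrow> 0) F" if x: "x \<in> B" for x
  proof (rule Lim_null_comparison)
    show "\<forall>\<^sub>F p in F. norm (cc p x) \<le> C * norm (Y p)"
      using cc by eventually_elim (use x in auto)
    show "((\<lambda>p. C * norm (Y p)) \<longlongrightarrow> 0) F"
      using tendsto_mult_right_zero[OF tendsto_norm_zero[OF Y_lim]] .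
  qed
  define R where "R = (\<lambda>p. \<Sum>x\<in>B. smult (cc p x) (q x))"
  have "\<forall>\<^sub>F p in F. \<exists>A'. finite A' \<and> card A' = card A \<and> root_poly A - R p = root_poly A'"
  proof (rule root_poly_perturbation[OF A(1)])
    show "\<forall>\<^sub>F p in F. \<forall>i\<ge>card A. coeff (R p) i = 0"
      using q B(1) by (intro always_eventually) (auto simp: R_def coeff_sum intro!: sum.neutral)
    fix i
    have "((\<lambda>p. \<Sum>x\<in>B. cc p x * coeff (q x) i) \<longlongrightarrow> (\<Sum>x\<in>B. 0 * coeff (q x) i)) F"
      by (intro tendsto_sum tendsto_mult_right cc_lim)
    then show "((\<lambda>p. coeff (R p) i) \<longlongrightarrow> 0) F"
      by (simp add: R_def coeff_sum)
  qed
  then show ?thesis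
    using C z_W_B cc y_T
  proof eventually_elim
    case (elim p)
    then obtain A' where A': "finite A'" "card A' = card A" "root_poly A - R p = root_poly A'"
      by blast
    have "splits (W p) (linear_form (U p)) D l A'"
      unfolding splits_def
    proof (intro conjI ballI)
      show "finite A'" "card A' \<le> D"
        using A A' by auto
      have "H p (root_poly A') = (\<Sum>x\<in>T. \<beta> x *\<^sub>R y x p) + (Y p - H p (R p))"
        by (simp add: Y_def H_def homogenization_diff flip: A'(3))
      also have "\<dots> \<in> W p"
        using elim(5) combination[OF elim(3), of "cc p"] elim(4) unfolding R_def
        by (intro subspace_add[OF W] subspace_sum[OF W] subspace_scale[OF W]) auto
      finally show "homogenization l (linear_form (U p)) D (root_poly A') \<in> W p"
        by (simp add: H_def)
      fix f :: "'v rpoly" assume "f \<in> forms D"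
      then obtain c where "f = (\<Sum>x\<in>B. c x *\<^sub>R z x p)"
        using elim(2) by blast
      then have "f - H p (\<Sum>x\<in>B. smult (c x) (q x)) \<in> W p"
        using combination[OF elim(3), of c] by simp
      moreover have "\<forall>i\<ge>card A'. coeff (\<Sum>x\<in>B. smult (c x) (q x)) i = 0"
        using q B(1) A'(2) by (auto simp: coeff_sum intro!: sum.neutral)
      ultimately show "\<exists>c. (\<forall>i\<ge>card A'. coeff c i = 0) \<and>
          f - homogenization l (linear_form (U p)) D c \<in> W p"
        unfolding H_def by blast
    qed
    then show ?case
      unfolding W_def l_def by blast
  qed
qed

section \<open>Splitting is an open condition on the Hilbert scheme\<close>

lemma tendsto_nhdsin_if_continuous_map:
  assumes "continuous_map X euclidean f" "a \<in> topspace X"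
  shows "(f \<longlongrightarrow> f a) (nhdsin X a)"
proof (rule topological_tendstoI)
  fix S assume "open S" "f a \<in> S"
  then have "openin X {x \<in> topspace X. f x \<in> S}"
    using assms(1) by (auto intro: openin_continuous_map_preimage)
  then show "\<forall>\<^sub>F x in nhdsin X a. f x \<in> S"
    using assms(2) \<open>f a \<in> S\<close> unfolding eventually_nhdsin by blast
qed

lemma eventually_nhdsin_topspace: "\<forall>\<^sub>F x in nhdsin X a. x \<in> topspace X"
  unfolding eventually_nhdsin using openin_topspace by blast

lemma topspace_forms_topology: "topspace (forms_topology d) = forms d"
  by (simp add: forms_topology_def topspace_pullback_topology)

lemma frames_topology_forms: "b \<in> topspace (frames_topology d r) \<Longrightarrow> j < r \<Longrightarrow> b j \<in> forms d"
  by (auto simp: frames_topology_def topspace_forms_topology PiE_iff)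

lemma continuous_map_lookup_frames:
  assumes "j < r"
  shows "continuous_map (frames_topology d r) euclideanreal (\<lambda>b. Poly_Mapping.lookup (b j) m)"
proof -
  have "continuous_map (forms_topology d) euclideanreal ((\<lambda>h. h m) \<circ> Poly_Mapping.lookup)"
    unfolding forms_topology_def
    by (intro continuous_map_pullback) (simp add: continuous_on_product_coordinates)
  moreover have "continuous_map (frames_topology d r) (forms_topology d) (\<lambda>b. b j)"
    unfolding frames_topology_def using assms
    by (intro continuous_map_from_subtopology continuous_map_product_projection) simp
  ultimately have "continuous_map (frames_topology d r) euclideanreal
      (((\<lambda>h. h m) \<circ> Poly_Mapping.lookup) \<circ> (\<lambda>b. b j))"
    by (rule continuous_map_compose[rotated])
  then show ?thesis
    by (simp add: comp_def)
qed

lemma tendsto_forms: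
  fixes x :: "'p \<Rightarrow> ('v::finite) rpoly"
  assumes "\<And>m. ((\<lambda>p. Poly_Mapping.lookup (x p) m) \<longlongrightarrow> Poly_Mapping.lookup y m) F"
    and "\<forall>\<^sub>F p in F. x p \<in> forms d" and "y \<in> forms d"
  shows "(x \<longlongrightarrow> y) F"
proof -
  have "((\<lambda>p. \<Sum>m\<in>{m. mdeg m = d}. Poly_Mapping.lookup (x p) m *\<^sub>R Poly_Mapping.single m (1::real))
      \<longlongrightarrow> (\<Sum>m\<in>{m. mdeg m = d}. Poly_Mapping.lookup y m *\<^sub>R Poly_Mapping.single m 1)) F"
    by (intro tendsto_sum tendsto_scaleR assms(1) tendsto_const)
  moreover have "\<forall>\<^sub>F p in F. (\<Sum>m\<in>{m. mdeg m = d}. Poly_Mapping.lookup (x p) m *\<^sub>R Poly_Mapping.single m 1) = x p"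
    using assms(2) by eventually_elim (simp flip: form_eq_sum_monomials)
  ultimately show ?thesis
    using form_eq_sum_monomials[OF assms(3)] by (simp add: tendsto_cong)
qed

definition fibre_part_splits :: "nat \<Rightarrow> ('v::finite) rpoly set \<Rightarrow> (real ^ 'v) set \<Rightarrow> real ^ 'v \<Rightarrow> bool" where
  "fibre_part_splits D V E u \<longleftrightarrow> (\<exists>a A. splits (fibre_part D V E u) (linear_form u) D (linear_form a) A)"

text \<open>In terms of frames of the degree \<open>D\<close> part of the ideal, \<open>splits_perturbation\<close> applies to the
  neighbourhood filter of a frame and a direction.\<close>

lemma openin_fibre_part_splits:
  assumes D: "D \<ge> 1"
  shows "openin (prod_topology (frames_topology D r) (top_of_set (directions E)))
    {x \<in> topspace (frames_topology D r) \<times> directions E. fibre_part_splits D (span (fst x ` {..<r})) E (snd x)}"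
    (is "openin ?X ?O")
proof (subst openin_subopen, rule ballI)
  fix x assume x: "x \<in> ?O"
  let ?F = "nhdsin ?X x"
  have x_top: "x \<in> topspace ?X"
    using x by auto
  have top: "\<forall>\<^sub>F y in ?F. y \<in> topspace ?X"
    by (rule eventually_nhdsin_topspace)
  obtain a A where s: "splits (fibre_part D (span (fst x ` {..<r})) E (snd x)) (linear_form (snd x)) D (linear_form a) A"
    using x by (auto simp: fibre_part_splits_def)
  have "\<forall>\<^sub>F y in ?F. \<exists>A'. splits (fibre_part D (span (fst y ` {..<r})) E (snd y)) (linear_form (snd y)) D (linear_form a) A'"
  proof (rule splits_perturbation[OF D _ _ _ _ _ _ s])
    fix j assume j: "j < r"
    show fx: "fst x j \<in> forms D"
      using frames_topology_forms[OF _ j] x by auto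
    show fy: "\<forall>\<^sub>F y in ?F. fst y j \<in> forms D"
      using top by eventually_elim (auto intro: frames_topology_forms[OF _ j])
    show "((\<lambda>y. fst y j) \<longlongrightarrow> fst x j) ?F"
    proof (rule tendsto_forms[OF _ fy fx])
      fix m
      have "continuous_map ?X euclideanreal ((\<lambda>b. Poly_Mapping.lookup (b j) m) \<circ> fst)"
        by (rule continuous_map_compose[OF continuous_map_fst continuous_map_lookup_frames[OF j]])
      then have "continuous_map ?X euclideanreal (\<lambda>y. Poly_Mapping.lookup (fst y j) m)"
        by (simp add: comp_def)
      from tendsto_nhdsin_if_continuous_map[OF this x_top]
      show "((\<lambda>y. Poly_Mapping.lookup (fst y j) m) \<longlongrightarrow> Poly_Mapping.lookup (fst x j) m) ?F" .
    qed
  next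
    have "continuous_map ?X euclidean snd"
      by (rule continuous_map_into_fulltopology[OF continuous_map_snd])
    then show "(snd \<longlongrightarrow> snd x) ?F"
      using x_top by (rule tendsto_nhdsin_if_continuous_map)
    show "\<forall>\<^sub>F y in ?F. snd y \<in> directions E"
      using top by eventually_elim auto
    show "snd x \<in> directions E"
      using x by auto
  qed
  with top have "\<forall>\<^sub>F y in ?F. y \<in> ?O"
  proof eventually_elim
    case (elim y)
    then show ?case
      by (cases y) (auto simp: fibre_part_splits_def)
  qed
  then show "\<exists>T. openin ?X T \<and> x \<in> T \<and> T \<subseteq> ?O"
    using x_top unfolding eventually_nhdsin by blast
qed

text \<open>The frames for which some direction violates the condition are the image of a closed set
  under a projection along the compact set of directions, which is a closed map.\<close>

lemma grassmannian_open_fibre_part_splits: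
  assumes D: "D \<ge> 1"
  shows "grassmannian_open D {V. subspace V \<and> V \<subseteq> forms D \<and> (\<forall>u\<in>directions E. fibre_part_splits D V E u)}"
    (is "grassmannian_open D ?W")
  unfolding grassmannian_open_def
proof (intro conjI ballI allI)
  fix V assume "V \<in> ?W"
  then show "rpoly.subspace V" "V \<subseteq> forms D"
    by (auto simp: rpoly_subspace)
next
  fix r
  let ?X = "frames_topology D r" and ?Y = "top_of_set (directions E)"
  let ?O = "{x \<in> topspace ?X \<times> directions E. fibre_part_splits D (span (fst x ` {..<r})) E (snd x)}"
  have "closedin (prod_topology ?X ?Y) (topspace (prod_topology ?X ?Y) - ?O)"
    using openin_fibre_part_splits[OF D] by blast
  moreover have "closed_map (prod_topology ?X ?Y) ?X fst"
    by (rule closed_map_fst) (simp add: compact_space_subtopology compact_directions)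
  ultimately have "closedin ?X (fst ` (topspace (prod_topology ?X ?Y) - ?O))"
    unfolding closed_map_def by blast
  moreover have "{b \<in> topspace ?X. span (b ` {..<r}) \<in> ?W}
      = topspace ?X - fst ` (topspace (prod_topology ?X ?Y) - ?O)"
  proof -
    have "span (b ` {..<r}) \<subseteq> forms D" if "b \<in> topspace ?X" for b
      using frames_topology_forms[OF that] by (intro span_minimal subspace_forms) auto
    moreover have "fst ` (topspace (prod_topology ?X ?Y) - ?O)
        = {b \<in> topspace ?X. \<exists>u\<in>directions E. \<not> fibre_part_splits D (span (b ` {..<r})) E u}"
      by force
    ultimately show ?thesis
      by auto
  qed
  ultimately show "openin ?X {b \<in> topspace ?X. rpoly.span (b ` {..<r}) \<in> ?W}"
    unfolding rpoly_span by (simp add: openin_diff)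
qed

lemma ex_frame:
  assumes "subspace V" "V \<subseteq> forms d"
  obtains r b where "b \<in> topspace (frames_topology d r)" "span (b ` {..<r}) = V"
proof -
  obtain B where B: "B \<subseteq> V" "independent B" "V \<subseteq> span B"
    by (rule maximal_independent_subset)
  have fin: "finite B"
    using finite_independent_forms[OF B(2)] B(1) assms(2) by blast
  obtain h where h: "bij_betw h {..<card B} B"
    using ex_bij_betw_nat_finite[OF fin] by (metis atLeast0LessThan)
  let ?b = "restrict h {..<card B}"
  have im: "?b ` {..<card B} = B"
    using h by (auto simp: bij_betw_def)
  have "h j \<in> forms d" if "j < card B" for j
    using h B(1) assms(2) that by (auto simp: bij_betw_def)
  then have "?b \<in> topspace (frames_topology d (card B))"
    using h B(2) im
    by (auto simp: frames_topology_def topspace_forms_topology rpoly_independent bij_betw_def inj_on_def)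
  moreover have "span (?b ` {..<card B}) = V"
    unfolding im using B assms(1) by (simp add: span_minimal subset_antisym)
  ultimately show thesis
    using that by blast
qed

definition totally_split :: "nat \<Rightarrow> (real ^ 'v) set \<Rightarrow> ('v::finite) rpoly set \<Rightarrow> bool" where
  "totally_split D E I \<longleftrightarrow> (\<forall>u\<in>directions E. \<exists>a A.
    splits (fibre_ideal E I u) (linear_form u) D (linear_form a) A)"

lemma fibre_part_splits_iff:
  assumes "homogeneous_ideal I" "D \<ge> 1"
  shows "fibre_part_splits D (I \<inter> forms D) E u \<longleftrightarrow>
    (\<exists>a A. splits (fibre_ideal E I u) (linear_form u) D (linear_form a) A)"
  using splits_fibre_part[OF assms] by (simp add: fibre_part_splits_def)

lemma subspace_homogeneous_part: "homogeneous_ideal I \<Longrightarrow> subspace (I \<inter> forms d)"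
  by (intro subspace_inter subspace_forms subspace_ideal homogeneous_idealD)

lemma splits_fibre_ideal_mono:
  assumes I: "homogeneous_ideal I"
    and s: "splits (fibre_ideal E I u) (linear_form u) D (linear_form a) A" and D: "D \<le> D'"
  shows "splits (fibre_ideal E I u) (linear_form u) D' (linear_form a) A"
  using splits_mono[OF homogeneous_idealD[OF homogeneous_linear_section[OF I]] linear_form_in_forms
      linear_form_in_forms s D] .

text \<open>In each degree \<open>d\<close> from \<open>D\<close> on, the condition \<open>totally_split d E\<close> defines a neighbourhood.\<close>

lemma hilbert_open_totally_split:
  "hilbert_open P {I \<in> hilbert_points P. \<exists>D\<ge>1. totally_split D E I}" (is "hilbert_open P ?A")
  unfolding hilbert_open_def
proof (intro conjI ballI)
  show "?A \<subseteq> hilbert_points P"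
    by blast
  fix I assume "I \<in> ?A"
  then obtain D where I: "I \<in> hilbert_points P" and D: "D \<ge> 1" "totally_split D E I"
    by blast
  have hom: "homogeneous_ideal J" if "J \<in> hilbert_points P" for J
    using that by (simp add: hilbert_points_def)
  have "\<exists>B. openin (hilbert_topology_in_degree P d) B \<and> I \<in> B \<and> B \<subseteq> ?A" if d: "d \<ge> D" for d
  proof -
    have d1: "d \<ge> 1"
      using d D by simp
    let ?W = "{V. subspace V \<and> V \<subseteq> forms d \<and> (\<forall>u\<in>directions E. fibre_part_splits d V E u)}"
    let ?B = "(\<lambda>I. I \<inter> forms d) -` ?W \<inter> hilbert_points P"
    have iff: "J \<in> ?B \<longleftrightarrow> totally_split d E J" if J: "J \<in> hilbert_points P" for J
      using J fibre_part_splits_iff[OF hom[OF J] d1] subspace_homogeneous_part[OF hom[OF J]]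
      by (simp add: totally_split_def)
    have "openin (hilbert_topology_in_degree P d) ?B"
      unfolding hilbert_topology_in_degree_def openin_pullback_topology openin_grassmannian_topology
      using grassmannian_open_fibre_part_splits[OF d1] by blast
    moreover have "totally_split d E I"
      using D(2) splits_fibre_ideal_mono[OF hom[OF I] _ d] unfolding totally_split_def by blast
    then have "I \<in> ?B"
      using iff[OF I] by blast
    moreover have "?B \<subseteq> ?A"
      using iff d1 by blast
    ultimately show ?thesis
      by blast
  qed
  then show "\<forall>\<^sub>F d in sequentially. \<exists>B. openin (hilbert_topology_in_degree P d) B \<and> I \<in> B \<and> B \<subseteq> ?A"
    unfolding eventually_sequentially by blast
qed

text \<open>The directions whose fibre splits in degree \<open>D\<close> form an open set, which increases with \<open>D\<close>;
  by compactness one of these sets contains all directions.\<close>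

lemma totally_split_if_pointwise:
  assumes I: "homogeneous_ideal I"
    and pt: "\<And>u. u \<in> directions E \<Longrightarrow> \<exists>D a A. splits (fibre_ideal E I u) (linear_form u) D (linear_form a) A"
  shows "\<exists>D\<ge>1. totally_split D E I"
proof -
  \<comment> \<open>The shift to \<open>Suc D\<close> keeps to positive degrees, where \<open>fibre_part\<close> is a part of an ideal.\<close>
  let ?G = "\<lambda>D. {u \<in> directions E. fibre_part_splits (Suc D) (I \<inter> forms (Suc D)) E u}"
  have iff: "fibre_part_splits (Suc D) (I \<inter> forms (Suc D)) E u \<longleftrightarrow>
    (\<exists>a A. splits (fibre_ideal E I u) (linear_form u) (Suc D) (linear_form a) A)" for D u
    by (rule fibre_part_splits_iff[OF I]) simp
  have "openin (top_of_set (directions E)) (?G D)" for D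
  proof -
    obtain r b where b: "b \<in> topspace (frames_topology (Suc D) r)"
      "span (b ` {..<r}) = I \<inter> forms (Suc D)"
      using ex_frame[OF subspace_homogeneous_part[OF I], of "Suc D"] by blast
    let ?X = "frames_topology (Suc D) r" and ?Y = "top_of_set (directions E)"
    have "continuous_map ?Y (prod_topology ?X ?Y) (\<lambda>u. (b, u))"
      using b(1) by (simp add: continuous_map_pairedI)
    from openin_continuous_map_preimage[OF this openin_fibre_part_splits[of "Suc D" r E]]
    have "openin ?Y {u \<in> topspace ?Y. (b, u) \<in> {x \<in> topspace ?X \<times> directions E.
        fibre_part_splits (Suc D) (span (fst x ` {..<r})) E (snd x)}}"
      by simp
    then show ?thesis
      using b by simp
  qed
  then have "\<forall>D. \<exists>T. open T \<and> ?G D = directions E \<inter> T"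
    by (simp add: openin_open)
  then obtain T where T: "\<And>D. open (T D)" "\<And>D. ?G D = directions E \<inter> T D"
    by metis
  have cover: "directions E \<subseteq> (\<Union>D\<in>UNIV. T D)"
  proof
    fix u assume u: "u \<in> directions E"
    then obtain D a A where "splits (fibre_ideal E I u) (linear_form u) D (linear_form a) A"
      using pt by blast
    then have "splits (fibre_ideal E I u) (linear_form u) (Suc D) (linear_form a) A"
      using splits_fibre_ideal_mono[OF I] by (metis le_SucI order_refl)
    then have "u \<in> ?G D"
      using u iff by blast
    then show "u \<in> (\<Union>D\<in>UNIV. T D)"
      using T(2) by blast
  qed
  obtain C where C: "finite C" "directions E \<subseteq> (\<Union>D\<in>C. T D)"
    using compactE_image[OF compact_directions _ cover] T(1) by metis
  define M where "M = Suc (Max (insert 0 C))"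
  have "\<exists>a A. splits (fibre_ideal E I u) (linear_form u) M (linear_form a) A" if u: "u \<in> directions E" for u
  proof -
    obtain D where D: "D \<in> C" "u \<in> ?G D"
      using C(2) T(2) u by blast
    then have "Suc D \<le> M"
      using C(1) by (simp add: M_def)
    moreover obtain a A where "splits (fibre_ideal E I u) (linear_form u) (Suc D) (linear_form a) A"
      using D iff by blast
    ultimately show ?thesis
      using splits_fibre_ideal_mono[OF I] by blast
  qed
  then have "totally_split M E I"
    by (simp add: totally_split_def)
  moreover have "M \<ge> 1"
    by (simp add: M_def)
  ultimately show ?thesis
    by blast
qed

section \<open>Splitting characterizes hyperbolic subschemes with unramified projection\<close>

lemma direction_not_in_span:
  assumes "u \<in> directions E"
  shows "u \<notin> span E"
proof
  assume "u \<in> span E"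
  moreover have "orthogonal u y" if "y \<in> E" for y
    using assms that by (auto simp: directions_def orthogonal_comp_def orthogonal_commute)
  ultimately have "orthogonal u u"
    using orthogonal_to_span by blast
  then show False
    using assms by (simp add: directions_def orthogonal_self)
qed

lemma dim_span_insert_direction:
  "u \<in> directions E \<Longrightarrow> dim (span (insert u E)) = dim E + 1"
  using direction_not_in_span[of u E] by (simp add: dim_insert)

lemma ex_direction:
  fixes E :: "(real ^ 'v::finite) set"
  assumes E: "subspace E" and U: "subspace U" "E \<subseteq> U" "dim U = dim E + 1"
  obtains u where "u \<in> directions E" "U = span (insert u E)"
proof -
  obtain x where x: "x \<in> U" "x \<notin> E"
    using U by (metis add_cancel_right_right subset_antisym subsetI zero_neq_one)
  obtain y z where y: "y \<in> span E" and z: "\<And>w. w \<in> span E \<Longrightarrow> orthogonal z w" and xyz: "x = y + z"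
    using orthogonal_subspace_decomp_exists[of E x] by metis
  have y: "y \<in> E"
    using y E by (metis span_eq_iff)
  then have "z \<noteq> 0"
    using x xyz by auto
  have "z \<in> U"
    using x y U xyz by (metis add_diff_cancel_left' subsetD subspace_diff)
  define u where "u = z /\<^sub>R norm z"
  have u: "u \<in> directions E"
    using z \<open>z \<noteq> 0\<close>
    by (auto simp: u_def directions_def orthogonal_comp_def orthogonal_def inner_commute span_base)
  have "u \<in> U"
    using \<open>z \<in> U\<close> U(1) by (simp add: u_def subspace_scale)
  then have "span (insert u E) \<subseteq> U"
    using U by (intro span_minimal) auto
  then have "span (insert u E) = U"
    using dim_span_insert_direction[OF u] U by (intro subspace_dim_equal) auto
  with u show thesis
    using that by blast
qed

lemma hyperbolic_unramified_if_totally_split: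
  fixes E :: "(real ^ 'v::finite) set"
  assumes I: "homogeneous_ideal I" and E: "subspace E" "dim E + k + 1 = CARD('v)"
    and off: "proj_points (linear_section E I) = {}" and dim: "has_dimension I k"
    and split: "totally_split D E I"
  shows "hyperbolic k E I \<and> (\<forall>p \<in> proj_points I. real_point p \<longrightarrow> unramified_at_real_point E I p)"
proof
  have sub: "ideal.subspace (linear_section U I)" for U
    by (simp add: linear_section_def)
  show "hyperbolic k E I"
    unfolding hyperbolic_def
  proof (intro conjI allI impI ballI dim E off)
    fix U p assume U: "subspace U \<and> dim U + k = CARD('v) \<and> E \<subseteq> U"
      and p: "p \<in> proj_points (linear_section U I)"
    then obtain u where u: "u \<in> directions E" "U = span (insert u E)"
      using ex_direction[OF E(1), of U] E(2) by auto
    then obtain a A where "splits (fibre_ideal E I u) (linear_form u) D (linear_form a) A"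
      using split by (auto simp: totally_split_def)
    then show "real_point p"
      using splits_real_point[OF sub linear_form_in_forms linear_form_in_forms]
        direction_not_in_point[OF off u(1)] p u(2) by blast
  qed
  show "\<forall>p \<in> proj_points I. real_point p \<longrightarrow> unramified_at_real_point E I p"
  proof (intro ballI impI)
    fix p assume p: "p \<in> proj_points I" and real: "real_point p"
    then obtain u where u: "u \<in> directions E" "p \<in> proj_points (fibre_ideal E I u)"
      using real_point_direction[OF p real off] by blast
    then obtain a A where s: "splits (fibre_ideal E I u) (linear_form u) D (linear_form a) A"
      using split by (auto simp: totally_split_def)
    note t = direction_not_in_point[OF off u]
    have "linear_equations (span (insert u E)) \<subseteq> p \<inter> projection_ring E"
    proof
      fix f assume f: "f \<in> linear_equations (span (insert u E))"
      then have "f \<in> fibre_ideal E I u"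
        using subset_linear_section(2) by blast
      then have "f \<in> p"
        using proj_pointsD(4)[OF u(2)] by blast
      moreover have "f \<in> linear_equations E"
        using f span_superset[of "insert u E"] by (auto simp: linear_equations_def)
      ultimately show "f \<in> p \<inter> projection_ring E"
        by (simp add: projection_ring.linear)
    qed
    then have J: "fibre_ideal E I u \<subseteq> ideal.span (I \<union> (p \<inter> projection_ring E))"
      unfolding linear_section_def by (intro ideal.span_mono) auto
    show "unramified_at_real_point E I p"
      unfolding unramified_at_real_point_def
    proof (intro allI ballI)
      fix d f assume "f \<in> p \<inter> forms d"
      then obtain e s where "s \<in> forms e - p" "s * f \<in> fibre_ideal E I u"
        using splits_unramified[OF sub linear_form_in_forms linear_form_in_forms s u(2) t] by blast
      then show "\<exists>e. \<exists>s\<in>forms e - p. s * f \<in> ideal.span (I \<union> (p \<inter> projection_ring E))"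
        using J by blast
    qed
  qed
qed

lemma totally_split_if_hyperbolic_unramified:
  fixes E :: "(real ^ 'v::finite) set"
  assumes I: "homogeneous_ideal I" and hyp: "hyperbolic k E I"
    and unram: "\<And>p. p \<in> proj_points I \<Longrightarrow> real_point p \<Longrightarrow> unramified_at_real_point E I p"
  shows "\<exists>D\<ge>1. totally_split D E I"
proof (rule totally_split_if_pointwise[OF I])
  fix u assume u: "u \<in> directions E"
  let ?J = "fibre_ideal E I u"
  have off: "proj_points (linear_section E I) = {}" and dim: "dim E + k + 1 = CARD('v)"
    using hyp by (auto simp: hyperbolic_def)
  obtain N where N: "forms N \<subseteq> linear_section E I"
    using proj_points_empty[OF homogeneous_linear_section[OF I] off] by blast
  have real: "real_point p" if p: "p \<in> proj_points ?J" for p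
  proof -
    have "subspace (span (insert u E))" "dim (span (insert u E)) + k = CARD('v)" "E \<subseteq> span (insert u E)"
      using dim_span_insert_direction[OF u] dim by (auto intro: span_base)
    then show ?thesis
      using hyp p unfolding hyperbolic_def by blast
  qed
  obtain D a A where "splits ?J (linear_form u) D (linear_form a) A"
  proof (rule splits_if_real_reduced[OF homogeneous_linear_section[OF I] linear_form_in_forms])
    show "\<exists>g\<in>forms N. f - linear_form u * g \<in> ?J" if "f \<in> forms (Suc N)" for f
      using forms_mod_fibre_ideal[OF I N u that] .
    fix p assume p: "p \<in> proj_points ?J"
    show t: "linear_form u \<notin> p"
      by (rule direction_not_in_point[OF off u p])
    show "real_point p"
      by (rule real[OF p])
    have "p \<in> proj_points I"
      using p subset_linear_section(1) by (auto simp: proj_points_def)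
    then have un: "unramified_at_real_point E I p"
      using unram real[OF p] by blast
    have "I \<union> (p \<inter> projection_ring E) \<subseteq> ?J"
      using subset_linear_section(1) projection_ring_subset_fibre_ideal[OF I u p t] by blast
    then have "ideal.span (I \<union> (p \<inter> projection_ring E)) \<subseteq> ?J"
      by (intro ideal.span_minimal) (simp_all add: linear_section_def)
    then show "\<exists>s. s \<notin> p \<and> s * f \<in> ?J" if "f \<in> p \<inter> forms d" for f d
      using un that unfolding unramified_at_real_point_def by blast
  qed
  then show "\<exists>D a A. splits ?J (linear_form u) D (linear_form a) A"
    by blast
qed

theorem theorem3p5:
  fixes E :: "(real ^ 'v::finite) set" and n k :: nat and P :: "rat poly"
  assumes "CARD('v) = n + 1" and "k \<le> n"
    and "subspace E" and "dim E = n - k"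
  shows "openin (subtopology (hilbert_topology P) (hilbert_points_off P k E))
    {I \<in> hilbert_points_off P k E.
      hyperbolic k E I \<and>
      (\<forall>p \<in> proj_points I. real_point p \<longrightarrow> unramified_at_real_point E I p)}"
proof -
  let ?A = "{I \<in> hilbert_points P. \<exists>D\<ge>1. totally_split D E I}"
  have "dim E + k + 1 = CARD('v)"
    using assms by simp
  then have "{I \<in> hilbert_points_off P k E. hyperbolic k E I \<and>
      (\<forall>p \<in> proj_points I. real_point p \<longrightarrow> unramified_at_real_point E I p)}
    = ?A \<inter> hilbert_points_off P k E"
    using hyperbolic_unramified_if_totally_split[OF _ assms(3), where k = k]
      totally_split_if_hyperbolic_unramified[where E = E and k = k]
    by (fastforce simp: hilbert_points_off_def hilbert_points_def)
  moreover have "openin (hilbert_topology P) ?A"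
    unfolding openin_hilbert_topology by (rule hilbert_open_totally_split)
  ultimately show ?thesis
    unfolding openin_subtopology by blast
qed

end
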